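(* Let $\Gamma$ be a finite, simplicial, incomplete, triangle-free graph without separating cliques. Then $\Gamma$ admits a FIDL--$\Lambda$ if and only if it admits a satellite-dismantling sequence $\Gamma=\Gamma_n\supset\Gamma_{n-1}\supset\dots\supset\Gamma_0$ (i.e. each $\Gamma_i$, $0\le i<n$, is the induced subgraph of $\Gamma_{i+1}$ obtained by deleting a single vertex that is a satellite in $\Gamma_{i+1}$) such that $\Gamma_0$ is a square, each $\Gamma_i$ is incomplete and triangle-free with no separating clique, and the following condition is satisfied. For $0\le i<n$ let $\{x_{i+1}\}:=\Gamma_{i+1}- \Gamma_i$ (difference of vertex sets), $N_i:=\mathrm{lk}_{\Gamma_{i+1}}(x_{i+1})$ and $V_i:=\{v\in\Gamma_i\mid N_i\subset \mathrm{lk}_{\Gamma_i}(v)\}$. The condition is: for every $0\le i<n$ there exists $v_i\in V_i$ such that for all $j$ with $i<j<n$, if $x_{i+1}\in N_j$ and $N_j\cap\Gamma_i\neq\emptyset$, then $v_i\in N_j$.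
   Context: Graphs are finite and simplicial; $v\in\Gamma$ means $v$ is a vertex of $\Gamma$. A graph is complete if every two distinct vertices are adjacent (the empty graph and a single vertex are complete), and incomplete otherwise. A clique is a complete subgraph (possibly empty). $\Gamma$ has a separating clique if there is a clique $C$ such that $\Gamma- C$ has more than one connected component. The link $\mathrm{lk}_\Gamma(v)$ is the induced subgraph on the neighbors of $v$ (identified with its vertex set). A vertex $v$ is a satellite of a vertex $w\ne v$ if $\mathrm{lk}(v)\subset\mathrm{lk}(w)$ (equality allowed); $v$ is a satellite if it is a satellite of some vertex. $A*B$ denotes the join (complete bipartite graph with parts $A$ and $B$). A square is a 4-cycle, written $\{a,b\}*\{c,d\}$ with $a\neq b$, $c\neq d$; $\{a,b\}$ and $\{c,d\}$ are its diagonals. $\Gamma^c$ is the complement graph of $\Gamma$. A cycle is a closed edge path with no repeated vertices. FIDL--$\Lambda$: Let $\Gamma$ be triangle-free. A FIDL--$\Lambda$ (finite index Dani--Levcovitz $\Lambda$) for $\Gamma$ is a subgraph $\Lambda=\Lambda_r\sqcup\Lambda_b$ of $\Gamma^c$, with $\Lambda_r,\Lambda_b$ disjoint connected subgraphs, such that: ($\mathcal R_1$) $\Lambda_r$ and $\Lambda_b$ are trees; ($\mathcal R_2$) $\Lambda_r$ and $\Lambda_b$ are induced subgraphs of the graph $\Theta$ whose vertex set is that of $\Gamma$ and whose edges are the edges of $\Gamma$ together with those of $\Lambda$; ($\mathcal F_1$) $\Lambda$ contains every vertex of $\Gamma$; ($\mathcal R_3$) if $\{a,b\}*\{c,d\}$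 is a square in $\Gamma$ then $\mathrm{hull}_\Lambda\{a,b\}*\mathrm{hull}_\Lambda\{c,d\}\subset\Gamma$; ($\mathcal R_4$) if $a,b$ are the endpoints of an edge of a cycle $\gamma$ in $\Gamma$ then there is a square $\{a,a'\}*\{b,b'\}$ in $\Gamma$ with $a',b'\in\mathrm{hull}_\Lambda(\gamma)$. Here $\mathrm{hull}_\Lambda(S)$ of a set $S$ of vertices is the vertex set of its convex hull in the forest $\Lambda$ (the union over the two components of the convex hull of the part of $S$ in that component). *)

theory Defs
  imports Graph_Theory.Graph_Theory
begin

text \<open>
  A finite simplicial graph is a \<^locale>\<open>pair_graph\<close>: a finite, loop-free, symmetric set of
  arcs, each undirected edge being the two arcs \<open>(u,v)\<close> and \<open>(v,u)\<close>. The map \<^const>\<open>with_proj\<close>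
  only turns such a graph into the general digraph type on which walks, components and
  subgraphs are defined.
\<close>

definition clique :: "'a pair_pre_digraph \<Rightarrow> 'a set \<Rightarrow> bool" where
  "clique G C \<longleftrightarrow> C \<subseteq> pverts G \<and> (\<forall>u\<in>C. \<forall>v\<in>C. u \<noteq> v \<longrightarrow> (u, v) \<in> parcs G)"

definition complete_graph :: "'a pair_pre_digraph \<Rightarrow> bool" where
  "complete_graph G \<longleftrightarrow> clique G (pverts G)"

text \<open>In a symmetric digraph the strongly connected components are the connected components.\<close>

definition has_separating_clique :: "'a pair_pre_digraph \<Rightarrow> bool" where
  "has_separating_clique G \<longleftrightarrow>
     (\<exists>C. clique G C \<and> card (pre_digraph.sccs_verts (with_proj G \<restriction> (pverts G - C))) > 1)"

definition triangle_free :: "'a pair_pre_digraph \<Rightarrow> bool" where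
  "triangle_free G \<longleftrightarrow>
     \<not> (\<exists>a b c. (a, b) \<in> parcs G \<and> (b, c) \<in> parcs G \<and> (c, a) \<in> parcs G)"

definition link :: "'a pair_pre_digraph \<Rightarrow> 'a \<Rightarrow> 'a set" where
  "link G v = {u \<in> pverts G. (v, u) \<in> parcs G}"

definition satellite_of :: "'a pair_pre_digraph \<Rightarrow> 'a \<Rightarrow> 'a \<Rightarrow> bool" where
  "satellite_of G v w \<longleftrightarrow>
     v \<in> pverts G \<and> w \<in> pverts G \<and> v \<noteq> w \<and> link G v \<subseteq> link G w"

definition satellite :: "'a pair_pre_digraph \<Rightarrow> 'a \<Rightarrow> bool" where
  "satellite G v \<longleftrightarrow> (\<exists>w. satellite_of G v w)"

text \<open>The two parts are meant to be disjoint; a join contained in a loop-free graph has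
  disjoint parts automatically.\<close>

definition join :: "'a set \<Rightarrow> 'a set \<Rightarrow> 'a pair_pre_digraph" where
  "join A B = \<lparr> pverts = A \<union> B, parcs = A \<times> B \<union> B \<times> A \<rparr>"

definition is_square :: "'a pair_pre_digraph \<Rightarrow> bool" where
  "is_square G \<longleftrightarrow> (\<exists>a b c d. distinct [a, b, c, d] \<and> G = join {a, b} {c, d})"

text \<open>\<open>square_in G a b c d\<close>: the square with diagonals \<open>{a,b}\<close> and \<open>{c,d}\<close> lies in \<open>G\<close>.\<close>

definition square_in :: "'a pair_pre_digraph \<Rightarrow> 'a \<Rightarrow> 'a \<Rightarrow> 'a \<Rightarrow> 'a \<Rightarrow> bool" where
  "square_in G a b c d \<longleftrightarrow>
     distinct [a, b, c, d] \<and> subgraph (with_proj (join {a, b} {c, d})) (with_proj G)"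

definition graph_complement :: "'a pair_pre_digraph \<Rightarrow> 'a pair_pre_digraph" where
  "graph_complement G =
     \<lparr> pverts = pverts G,
       parcs = {(u, v). u \<in> pverts G \<and> v \<in> pverts G \<and> u \<noteq> v \<and> (u, v) \<notin> parcs G} \<rparr>"

text \<open>The library's directed cycles include the back-and-forth walk \<open>u,v,u\<close> along one edge (so
  its \<^const>\<open>tree\<close> excludes every symmetric graph with an edge); an undirected cycle has length
  at least 3.\<close>

definition graph_cycle :: "'a pair_pre_digraph \<Rightarrow> ('a \<times> 'a) list \<Rightarrow> bool" where
  "graph_cycle G p \<longleftrightarrow> pre_digraph.cycle (with_proj G) p \<and> 3 \<le> length p"

definition is_tree :: "'a pair_pre_digraph \<Rightarrow> bool" where
  "is_tree T \<longleftrightarrow> pair_graph T \<and> connected (with_proj T) \<and> \<not> (\<exists>p. graph_cycle T p)"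

text \<open>In a tree the paths without repeated vertices are the geodesics.\<close>

definition tree_convex :: "'a pair_pre_digraph \<Rightarrow> 'a set \<Rightarrow> bool" where
  "tree_convex T C \<longleftrightarrow> C \<subseteq> pverts T \<and>
     (\<forall>u\<in>C. \<forall>v\<in>C. \<forall>p. pre_digraph.apath (with_proj T) u p v \<longrightarrow> set (pawalk_verts u p) \<subseteq> C)"

definition tree_hull :: "'a pair_pre_digraph \<Rightarrow> 'a set \<Rightarrow> 'a set" where
  "tree_hull T S = \<Inter> {C. tree_convex T C \<and> S \<subseteq> C}"

definition forest_hull :: "'a pair_pre_digraph \<Rightarrow> 'a pair_pre_digraph \<Rightarrow> 'a set \<Rightarrow> 'a set" where
  "forest_hull \<Lambda>r \<Lambda>b S = tree_hull \<Lambda>r (S \<inter> pverts \<Lambda>r) \<union> tree_hull \<Lambda>b (S \<inter> pverts \<Lambda>b)"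

definition theta_graph ::
    "'a pair_pre_digraph \<Rightarrow> 'a pair_pre_digraph \<Rightarrow> 'a pair_pre_digraph \<Rightarrow> 'a pair_pre_digraph" where
  "theta_graph \<Gamma> \<Lambda>r \<Lambda>b =
     \<lparr> pverts = pverts \<Gamma>, parcs = parcs \<Gamma> \<union> (parcs \<Lambda>r \<union> parcs \<Lambda>b) \<rparr>"

text \<open>The graph \<open>\<Lambda>\<close> is given by its two components. A cycle is a list of consecutive arcs,
  so its vertices are the sources of its arcs. The last condition is symmetric under exchanging
  \<open>a,a'\<close> with \<open>b,b'\<close>, so the orientation of the cycle is immaterial.\<close>

definition FIDL :: "'a pair_pre_digraph \<Rightarrow> 'a pair_pre_digraph \<Rightarrow> 'a pair_pre_digraph \<Rightarrow> bool" where
  "FIDL \<Gamma> \<Lambda>r \<Lambda>b \<longleftrightarrow>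
     pair_graph \<Lambda>r \<and> pair_graph \<Lambda>b \<and>
     subgraph (with_proj \<Lambda>r) (with_proj (graph_complement \<Gamma>)) \<and>
     subgraph (with_proj \<Lambda>b) (with_proj (graph_complement \<Gamma>)) \<and>
     pverts \<Lambda>r \<inter> pverts \<Lambda>b = {} \<and>
     connected (with_proj \<Lambda>r) \<and> connected (with_proj \<Lambda>b) \<and>
     is_tree \<Lambda>r \<and> is_tree \<Lambda>b \<and>
     induced_subgraph (with_proj \<Lambda>r) (with_proj (theta_graph \<Gamma> \<Lambda>r \<Lambda>b)) \<and>
     induced_subgraph (with_proj \<Lambda>b) (with_proj (theta_graph \<Gamma> \<Lambda>r \<Lambda>b)) \<and>
     pverts \<Gamma> \<subseteq> pverts \<Lambda>r \<union> pverts \<Lambda>b \<and>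
     (\<forall>a b c d. square_in \<Gamma> a b c d \<longrightarrow>
        subgraph (with_proj (join (forest_hull \<Lambda>r \<Lambda>b {a, b}) (forest_hull \<Lambda>r \<Lambda>b {c, d})))
          (with_proj \<Gamma>)) \<and>
     (\<forall>\<gamma> a b. graph_cycle \<Gamma> \<gamma> \<and> (a, b) \<in> set \<gamma> \<longrightarrow>
        (\<exists>a'\<in>forest_hull \<Lambda>r \<Lambda>b (fst ` set \<gamma>). \<exists>b'\<in>forest_hull \<Lambda>r \<Lambda>b (fst ` set \<gamma>).
           square_in \<Gamma> a a' b b'))"

text \<open>\<open>satellite_dismantling G x n\<close>: the graphs \<open>G n, \<dots>, G 0\<close> form a satellite-dismantling
  sequence in which \<open>x (i + 1)\<close> is the vertex of \<open>G (i + 1)\<close> deleted to obtain \<open>G i\<close>; the values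
  of \<open>x\<close> outside \<open>{1..n}\<close> are irrelevant.\<close>

definition satellite_dismantling ::
    "(nat \<Rightarrow> 'a pair_pre_digraph) \<Rightarrow> (nat \<Rightarrow> 'a) \<Rightarrow> nat \<Rightarrow> bool" where
  "satellite_dismantling G x n \<longleftrightarrow>
     (\<forall>i<n. satellite (G (Suc i)) (x (Suc i)) \<and>
        induced_subgraph (with_proj (G i)) (with_proj (G (Suc i))) \<and>
        pverts (G i) = pverts (G (Suc i)) - {x (Suc i)})"

definition deleted_link :: "(nat \<Rightarrow> 'a pair_pre_digraph) \<Rightarrow> (nat \<Rightarrow> 'a) \<Rightarrow> nat \<Rightarrow> 'a set" where
  "deleted_link G x i = link (G (Suc i)) (x (Suc i))"

definition dominators :: "(nat \<Rightarrow> 'a pair_pre_digraph) \<Rightarrow> (nat \<Rightarrow> 'a) \<Rightarrow> nat \<Rightarrow> 'a set" where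
  "dominators G x i = {v \<in> pverts (G i). deleted_link G x i \<subseteq> link (G i) v}"

end

theory Submission
  imports Defs
begin

text \<open>
  Let \<open>V\<close> and \<open>E\<close> be the vertices and arcs of \<open>\<Gamma>\<close>, and \<open>L\<close> the arcs of the forest \<open>\<Lambda>\<close>. The two
  trees are induced in \<open>\<Theta>\<close> but consist of non-edges of \<open>\<Gamma>\<close>, so no edge of \<open>\<Gamma>\<close> has both ends in
  one tree: \<open>\<Gamma>\<close> is bipartite, each tree spans one colour class, and two vertices with a common
  neighbour lie in the same tree. Call a set convex if it meets each tree in a subtree. The cycle
  condition then says: for every convex \<open>H\<close>, each edge that is not a bridge of the subgraph induced
  on \<open>H\<close> lies in a square of that subgraph (\<open>FIDL_iff_relational\<close>).

  From a forest to a dismantling sequence. Let \<open>x\<close> be a leaf of a convex set \<open>W\<close>, with tree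
  neighbour \<open>v\<close> in \<open>W\<close>, and let \<open>xy\<close> be a non-bridge in \<open>W\<close>. Some square in \<open>W\<close> has diagonals
  \<open>{x,x'}\<close> and \<open>{y,y'}\<close>; the tree path from \<open>x\<close> to \<open>x'\<close> starts with \<open>v\<close>, so the square condition
  makes \<open>v\<close> adjacent to \<open>y\<close> (\<open>parent_dominates\<close>). If no vertex separates, then every edge is a
  non-bridge and each leaf is a satellite of its parent. Deleting an arbitrary leaf may create a
  separating clique, however, so the sequence is built from the bottom. There is a convex square
  (\<open>convex_square\<close>), and a proper convex subset \<open>H\<close> without separating clique can be enlarged by a
  vertex that has a tree neighbour and two graph neighbours in \<open>H\<close> (\<open>convex_extension\<close>); this
  creates no separating clique. For the last condition, \<open>v\<^sub>i\<close> lies on the tree path from \<open>x\<^sub>i\<^sub>+\<^sub>1\<close>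
  to any vertex of \<open>\<Gamma>\<^sub>i\<close> in its tree, and the square condition applies to the square with diagonals
  \<open>{x\<^sub>j\<^sub>+\<^sub>1, v\<^sub>j}\<close> and two elements of \<open>N\<^sub>j\<close>.

  From a dismantling sequence to a forest. Start with the two diagonals of the square and attach
  \<open>x\<^sub>i\<^sub>+\<^sub>1\<close> to \<open>v\<^sub>i\<close> as a leaf. The last condition says precisely that every \<open>N\<^sub>j\<close> stays convex, and
  then the links of all vertices are convex, which implies the square condition. The cycle condition
  survives because replacing \<open>x\<^sub>i\<^sub>+\<^sub>1\<close> by \<open>v\<^sub>i\<close> pushes a cycle into the smaller graph without
  enlarging its hull (\<open>attach_leaf\<close>).
\<close>

section \<open>Walks as reflexive transitive closures\<close>

definition conn_on :: "('a \<times> 'a) set \<Rightarrow> 'a set \<Rightarrow> bool" where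
  "conn_on E C \<longleftrightarrow> (\<forall>u\<in>C. \<forall>v\<in>C. (u, v) \<in> (E \<inter> C \<times> C)\<^sup>*)"

text \<open>
  An edge lies on a cycle if and only if it is not a bridge, that is, if its ends stay connected
  without it. This form needs walks only, so that cycles can be rerouted without caring
  about repeated vertices.
\<close>

definition on_cycle :: "('a \<times> 'a) set \<Rightarrow> 'a set \<Rightarrow> 'a \<Rightarrow> 'a \<Rightarrow> bool" where
  "on_cycle E H a b \<longleftrightarrow>
     (a, b) \<in> E \<inter> H \<times> H \<and> (a, b) \<in> (E \<inter> H \<times> H - {(a, b), (b, a)})\<^sup>*"

lemma rtrancl_map:
  assumes "(p, q) \<in> A\<^sup>*" and "\<And>s t. (s, t) \<in> A \<Longrightarrow> (f s, f t) \<in> B\<^sup>*"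
  shows "(f p, f q) \<in> B\<^sup>*"
  using assms(1) by induction (auto intro: rtrancl_trans assms(2))

lemma rtrancl_restrict_stays:
  assumes "(p, q) \<in> (E \<inter> H \<times> H)\<^sup>*" "p \<in> H" shows "q \<in> H"
  using assms by induction auto

lemma rtrancl_exit:
  assumes "(p, q) \<in> A\<^sup>*" "p \<in> S" "q \<notin> S"
  obtains s t where "s \<in> S" "t \<notin> S" "(s, t) \<in> A"
proof -
  have "q \<in> S" if "\<And>s t. s \<in> S \<Longrightarrow> (s, t) \<in> A \<Longrightarrow> t \<in> S"
    using assms(1,2) by (induction rule: rtrancl_induct) (auto intro: that)
  then show thesis using that assms(3) by blast
qed

lemma rtrancl_first_step: "(p, q) \<in> A\<^sup>* \<Longrightarrow> p \<noteq> q \<Longrightarrow> \<exists>y. (p, y) \<in> A"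
  by (auto elim: converse_rtranclE)

lemma rtrancl_last_step: "(p, q) \<in> A\<^sup>* \<Longrightarrow> p \<noteq> q \<Longrightarrow> \<exists>y. (y, q) \<in> A"
  by (auto elim: rtranclE)

lemma rtrancl_sym: "sym E \<Longrightarrow> (p, q) \<in> E\<^sup>* \<Longrightarrow> (q, p) \<in> E\<^sup>*"
  by (meson symD sym_rtrancl)

lemma sym_restrict: "sym E \<Longrightarrow> sym (E \<inter> H \<times> H)"
  by (auto simp: sym_def)

lemma sym_minus_edge: "sym E \<Longrightarrow> sym (E - {(a, b), (b, a)})"
  by (auto simp: sym_def)

lemma on_cycle_sym: "sym E \<Longrightarrow> on_cycle E H a b \<Longrightarrow> on_cycle E H b a"
  unfolding on_cycle_def insert_commute[of "(b, a)"]
  using rtrancl_sym[OF sym_minus_edge[OF sym_restrict], of E a b H a b] by (auto dest: symD)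

text \<open>
  The cycle goes from \<open>x\<close> to \<open>z\<close>, then inside \<open>M\<close> to \<open>y\<close>, and back to \<open>x\<close>.
\<close>

lemma on_cycle_through:
  assumes "x \<notin> M" "y \<noteq> z" "y \<in> M" "z \<in> M" "(x, y) \<in> E" "(x, z) \<in> E"
    and "(z, y) \<in> (E \<inter> M \<times> M)\<^sup>*"
  shows "on_cycle E (insert x M) x y"
proof -
  let ?A = "E \<inter> insert x M \<times> insert x M - {(x, y), (y, x)}"
  have "(z, y) \<in> ?A\<^sup>*"
    using assms(7) by (rule rtrancl_mono[THEN subsetD, rotated]) (use assms in auto)
  moreover have "(x, z) \<in> ?A" using assms by auto
  ultimately show ?thesis
    unfolding on_cycle_def using assms by (auto intro: converse_rtrancl_into_rtrancl)
qed

lemma conn_on_hub: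
  assumes "sym E" "\<And>u. u \<in> C \<Longrightarrow> (u, h) \<in> (E \<inter> C \<times> C)\<^sup>*"
  shows "conn_on E C"
  unfolding conn_on_def
  using rtrancl_trans[OF assms(2) rtrancl_sym[OF sym_restrict[OF assms(1)] assms(2)]] by blast

lemma conn_on_insert:
  assumes "sym E" "conn_on E C" "a \<in> C" "(x, a) \<in> E"
  shows "conn_on E (insert x C)"
proof -
  let ?A = "E \<inter> insert x C \<times> insert x C"
  have to_a: "(u, a) \<in> ?A\<^sup>*" if "u \<in> insert x C" for u
  proof (cases "u = x")
    case True then show ?thesis using assms by auto
  next
    case False
    then have "(u, a) \<in> (E \<inter> C \<times> C)\<^sup>*" using that assms unfolding conn_on_def by auto
    then show ?thesis by (rule rtrancl_mono[THEN subsetD, rotated]) auto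
  qed
  show ?thesis by (rule conn_on_hub[OF assms(1) to_a])
qed

section \<open>Convex sets in a forest\<close>

text \<open>
  In a forest \<open>L\<close> this is geodesic convexity: any two vertices of \<open>H\<close> in the same tree are joined
  inside \<open>H\<close>. Treating both trees as one relation avoids a case distinction on colours.
\<close>

definition convex_in :: "('a \<times> 'a) set \<Rightarrow> 'a set \<Rightarrow> bool" where
  "convex_in L H \<longleftrightarrow> (\<forall>u\<in>H. \<forall>v\<in>H. (u, v) \<in> L\<^sup>* \<longrightarrow> (u, v) \<in> (L \<inter> H \<times> H)\<^sup>*)"

definition hull_in :: "'a set \<Rightarrow> ('a \<times> 'a) set \<Rightarrow> 'a set \<Rightarrow> 'a set" where
  "hull_in V L S = \<Inter> {H. H \<subseteq> V \<and> convex_in L H \<and> S \<subseteq> H}"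

lemma convex_insert:
  assumes "sym L" "convex_in L M" "v \<in> M" "(x, v) \<in> L"
  shows "convex_in L (insert x M)"
  unfolding convex_in_def
proof (intro ballI impI)
  let ?A = "L \<inter> insert x M \<times> insert x M"
  have mono: "(L \<inter> M \<times> M)\<^sup>* \<subseteq> ?A\<^sup>*" by (rule rtrancl_mono) auto
  have x: "(x, w) \<in> ?A\<^sup>*" if w: "w \<in> insert x M" "(x, w) \<in> L\<^sup>*" for w
  proof (cases "w = x")
    case False
    have "(v, w) \<in> L\<^sup>*" using assms w by (meson converse_rtrancl_into_rtrancl symD)
    then have "(v, w) \<in> ?A\<^sup>*" using False w assms mono unfolding convex_in_def by auto
    moreover have "(x, v) \<in> ?A" using assms by auto
    ultimately show ?thesis by (rule converse_rtrancl_into_rtrancl[rotated])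
  qed auto
  fix u w assume uw: "u \<in> insert x M" "w \<in> insert x M" "(u, w) \<in> L\<^sup>*"
  show "(u, w) \<in> ?A\<^sup>*"
  proof (cases "u = x \<or> w = x")
    case True
    then show ?thesis using x uw rtrancl_sym[OF sym_restrict[OF assms(1)]]
      rtrancl_sym[OF assms(1)] by metis
  next
    case False
    then show ?thesis using uw assms mono unfolding convex_in_def by auto
  qed
qed

text \<open>
  Convexity is a condition on each tree separately, so \<open>H\<close> may be used in the tree of \<open>u\<close> and \<open>W\<close> in
  all others.
\<close>

lemma convex_mix_components:
  assumes "sym L" "convex_in L H" "convex_in L W" "H \<subseteq> W"
  shows "convex_in L (H \<union> {w \<in> W. (u, w) \<notin> L\<^sup>*})"
  unfolding convex_in_def
proof (intro ballI impI)
  let ?K = "H \<union> {w \<in> W. (u, w) \<notin> L\<^sup>*}"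
  fix p q assume pq: "p \<in> ?K" "q \<in> ?K" "(p, q) \<in> L\<^sup>*"
  show "(p, q) \<in> (L \<inter> ?K \<times> ?K)\<^sup>*"
  proof (cases "(u, p) \<in> L\<^sup>*")
    case True
    then have "p \<in> H" "q \<in> H" using pq rtrancl_trans[OF True pq(3)] by auto
    then have "(p, q) \<in> (L \<inter> H \<times> H)\<^sup>*" using assms pq unfolding convex_in_def by auto
    then show ?thesis by (rule rtrancl_mono[THEN subsetD, rotated]) auto
  next
    case False
    have "(p, q) \<in> (L \<inter> W \<times> W)\<^sup>*" using assms(3,4) pq unfolding convex_in_def by auto
    then have "(p, q) \<in> (L \<inter> ?K \<times> ?K)\<^sup>* \<and> (u, q) \<notin> L\<^sup>*"
    proof induction
      case (step s t)
      then have "(u, t) \<notin> L\<^sup>*" using assms(1)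
        by (metis IntE rtrancl_into_rtrancl symD)
      then show ?case using step by (auto intro!: rtrancl_into_rtrancl[of p s])
    qed (use False in auto)
    then show ?thesis by simp
  qed
qed

text \<open>
  The acyclicity of \<open>L\<close> is expressed by all its edges being bridges. The last two assumptions say
  that \<open>E\<close> joins different trees and, if \<open>E\<close> is not empty, that there are only two of them.
\<close>

locale two_coloured_forest =
  fixes V :: "'a set" and E L :: "('a \<times> 'a) set"
  assumes finite_V: "finite V"
    and E_sub: "E \<subseteq> V \<times> V" and E_sym: "sym E"
    and L_sub: "L \<subseteq> V \<times> V" and L_sym: "sym L"
    and L_bridge: "(u, v) \<in> L \<Longrightarrow> (u, v) \<notin> (L - {(u, v), (v, u)})\<^sup>*"
    and E_colour: "(u, v) \<in> E \<Longrightarrow> (u, v) \<notin> L\<^sup>*"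
    and two_colours: "(u, v) \<in> E \<Longrightarrow> w \<in> V \<Longrightarrow> (u, w) \<in> L\<^sup>* \<or> (v, w) \<in> L\<^sup>*"
begin

lemma E_commute: "(u, v) \<in> E \<Longrightarrow> (v, u) \<in> E" using E_sym by (rule symD)
lemma L_commute: "(u, v) \<in> L \<Longrightarrow> (v, u) \<in> L" using L_sym by (rule symD)
lemma E_irrefl: "(u, u) \<notin> E" using E_colour by blast
lemma L_irrefl: "(u, u) \<notin> L" using L_bridge by blast
lemma E_V: "(u, v) \<in> E \<Longrightarrow> u \<in> V \<and> v \<in> V" using E_sub by auto
lemma L_V: "(u, v) \<in> L \<Longrightarrow> u \<in> V \<and> v \<in> V" using L_sub by auto
lemmas Lstar_commute = rtrancl_sym[OF L_sym]

lemma convex_V: "convex_in L V"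
  unfolding convex_in_def using L_sub by (simp add: inf.absorb1)

lemma same_colour: "(a, c) \<in> E \<Longrightarrow> (b, c) \<in> E \<Longrightarrow> (a, b) \<in> L\<^sup>*"
  using two_colours[of a c b] E_colour[of b c] E_V Lstar_commute by blast

text \<open>
  A convex set with \<open>x\<close> and \<open>x'\<close> but without \<open>v\<close> would allow to go from \<open>x\<close> via \<open>x'\<close> to \<open>v\<close> without
  using the bridge \<open>xv\<close>.
\<close>

lemma parent_in_hull:
  assumes "convex_in L M" "x \<notin> M" "v \<in> M" "(x, v) \<in> L" "x' \<in> M" "(x, x') \<in> L\<^sup>*"
  shows "v \<in> hull_in V L {x, x'}"
proof (rule ccontr)
  assume "v \<notin> hull_in V L {x, x'}"
  then obtain C where C: "convex_in L C" "x \<in> C" "x' \<in> C" "v \<notin> C"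
    unfolding hull_in_def by auto
  let ?A = "L - {(x, v), (v, x)}"
  have "(x, x') \<in> (L \<inter> C \<times> C)\<^sup>*" using C assms unfolding convex_in_def by auto
  then have "(x, x') \<in> ?A\<^sup>*" by (rule rtrancl_mono[THEN subsetD, rotated]) (use C in auto)
  moreover have "(x', v) \<in> L\<^sup>*" using assms Lstar_commute by (meson rtrancl_into_rtrancl)
  then have "(x', v) \<in> (L \<inter> M \<times> M)\<^sup>*" using assms unfolding convex_in_def by auto
  then have "(x', v) \<in> ?A\<^sup>*" by (rule rtrancl_mono[THEN subsetD, rotated]) (use assms in auto)
  ultimately show False using L_bridge[OF assms(4)] by (meson rtrancl_trans)
qed

lemma neighbour_towards:
  assumes "p \<noteq> q" "(p, q) \<in> L\<^sup>*"
  obtains v where "(p, v) \<in> L" "v \<in> hull_in V L {p, q}"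
proof -
  \<comment> \<open>\<open>M\<close> is the component of \<open>q\<close> after deletion of \<open>p\<close>; it is convex and touches \<open>p\<close>.\<close>
  define A where "A = L \<inter> (- {p}) \<times> (- {p})"
  define M where "M = {w. (q, w) \<in> A\<^sup>*}"
  have A_sym: "sym A" unfolding A_def by (rule sym_restrict[OF L_sym])
  have q: "q \<in> M" and p: "p \<notin> M"
    using rtrancl_restrict_stays[of q p L "- {p}"] assms(1) by (auto simp: M_def A_def)
  have "convex_in L M" unfolding convex_in_def
  proof (intro ballI impI)
    fix u w assume uw: "u \<in> M" "w \<in> M"
    then have "(u, w) \<in> A\<^sup>*" using rtrancl_sym[OF A_sym] unfolding M_def by (auto intro: rtrancl_trans)
    then show "(u, w) \<in> (L \<inter> M \<times> M)\<^sup>*"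
    proof induction
      case (step s t)
      then have "(q, s) \<in> A\<^sup>*" "(q, t) \<in> A\<^sup>*" using uw unfolding M_def
        by (auto intro: rtrancl_trans rtrancl_into_rtrancl)
      then have "(s, t) \<in> L \<inter> M \<times> M" using step unfolding M_def A_def by auto
      then show ?case using step by (meson rtrancl_into_rtrancl)
    qed auto
  qed
  moreover obtain v t where vt: "v \<in> M" "t \<notin> M" "(v, t) \<in> L"
    using rtrancl_exit[OF Lstar_commute[OF assms(2)] q p] by metis
  have "t = p"
  proof (rule ccontr)
    assume "t \<noteq> p"
    then have "(v, t) \<in> A" using vt p unfolding A_def by auto
    then show False using vt unfolding M_def by (auto intro: rtrancl_into_rtrancl)
  qed
  ultimately have "v \<in> hull_in V L {p, q}"
    using parent_in_hull[OF _ p vt(1) _ q assms(2)] vt L_commute by blast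
  then show thesis using that vt \<open>t = p\<close> L_commute by blast
qed

text \<open>
  A maximal convex proper subset of \<open>W\<close> that contains \<open>H\<close> and all vertices of \<open>W\<close> outside the tree of
  \<open>u\<close> misses exactly one vertex, since otherwise it could be enlarged by a tree neighbour. The
  missing vertex is a leaf of \<open>W\<close> of the same colour as \<open>u\<close>.
\<close>

lemma leaf_outside:
  assumes "convex_in L H" "convex_in L W" "H \<subseteq> W" "W \<subseteq> V" "u \<in> W - H" "h \<in> H" "(h, u) \<in> L\<^sup>*"
  obtains x v where "x \<in> W - H" "(u, x) \<in> L\<^sup>*" "convex_in L (W - {x})" "v \<in> W - {x}" "(x, v) \<in> L"
proof -
  define K where "K = H \<union> {w \<in> W. (u, w) \<notin> L\<^sup>*}"
  define \<M> where "\<M> = {M. K \<subseteq> M \<and> M \<subseteq> W \<and> M \<noteq> W \<and> convex_in L M}"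
  have "K \<in> \<M>" using convex_mix_components[OF L_sym assms(1-3)] assms
    unfolding \<M>_def K_def by auto
  moreover have "finite \<M>"
    by (rule finite_subset[of _ "Pow V"]) (use assms finite_V in \<open>auto simp: \<M>_def\<close>)
  ultimately obtain M where M: "M \<in> \<M>" and max: "\<And>M'. M' \<in> \<M> \<Longrightarrow> M \<subseteq> M' \<Longrightarrow> M' = M"
    using finite_has_maximal[of \<M>] by blast
  have MD: "K \<subseteq> M" "M \<subseteq> W" "M \<noteq> W" "convex_in L M" using M unfolding \<M>_def by auto
  obtain p where p: "p \<in> W" "p \<notin> M" using MD by auto
  have "(u, p) \<in> L\<^sup>*" using p MD unfolding K_def by auto
  then have "(h, p) \<in> L\<^sup>*" using assms by (meson rtrancl_trans)
  then have "(h, p) \<in> (L \<inter> W \<times> W)\<^sup>*" using assms p unfolding convex_in_def by auto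
  moreover have "h \<in> M" using assms MD unfolding K_def by auto
  ultimately obtain v x where vx: "v \<in> M" "x \<notin> M" "(v, x) \<in> L \<inter> W \<times> W"
    using p(2) by (rule rtrancl_exit)
  have "insert x M = W"
  proof (rule ccontr)
    assume "insert x M \<noteq> W"
    then have "insert x M \<in> \<M>"
      using convex_insert[OF L_sym MD(4) vx(1)] vx MD L_commute unfolding \<M>_def by auto
    then show False using max[of "insert x M"] vx by auto
  qed
  then have "W - {x} = M" using vx by auto
  moreover have "x \<in> W - H" "(u, x) \<in> L\<^sup>*" using vx MD unfolding K_def by auto
  ultimately show thesis using that[of x v] MD vx L_commute by auto
qed

end

text \<open>
  The conditions on squares and cycles. The second one is stated for all convex \<open>H\<close> instead of hulls
  of cycles: such a hull is convex, and the hull of a cycle in a convex \<open>H\<close> stays in \<open>H\<close>.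
\<close>

locale relational_FIDL = two_coloured_forest +
  assumes square_hull:
    "a \<noteq> b \<Longrightarrow> c \<noteq> d \<Longrightarrow> (a, c) \<in> E \<Longrightarrow> (a, d) \<in> E \<Longrightarrow> (b, c) \<in> E \<Longrightarrow> (b, d) \<in> E \<Longrightarrow>
     e \<in> hull_in V L {a, b} \<Longrightarrow> f \<in> hull_in V L {c, d} \<Longrightarrow> (e, f) \<in> E"
    and cycle_square:
    "H \<subseteq> V \<Longrightarrow> convex_in L H \<Longrightarrow> on_cycle E H a b \<Longrightarrow>
     \<exists>a'\<in>H. \<exists>b'\<in>H. a' \<noteq> a \<and> b' \<noteq> b \<and> (a, b') \<in> E \<and> (a', b) \<in> E \<and> (a', b') \<in> E"
begin

text \<open>
  The cycle condition yields a square with diagonals \<open>{x,x'}\<close> and \<open>{y,y'}\<close> in \<open>W\<close>. The tree path from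
  the leaf \<open>x\<close> to \<open>x'\<close> passes through \<open>v\<close>, so the square condition gives the edge \<open>vy\<close>.
\<close>

lemma parent_dominates:
  assumes "W \<subseteq> V" "convex_in L W" "convex_in L (W - {x})" "v \<in> W - {x}" "(x, v) \<in> L"
    and "on_cycle E W x y"
  shows "(v, y) \<in> E"
proof -
  obtain x' y' where sq: "x' \<in> W" "x' \<noteq> x" "y' \<noteq> y" "(x, y') \<in> E" "(x', y) \<in> E" "(x', y') \<in> E"
    using cycle_square[OF assms(1,2,6)] by auto
  have xy: "(x, y) \<in> E" using assms unfolding on_cycle_def by auto
  have "v \<in> hull_in V L {x, x'}"
    using parent_in_hull[OF assms(3) _ assms(4,5)] sq same_colour[OF xy sq(5)] by auto
  moreover have "y \<in> hull_in V L {y, y'}" unfolding hull_in_def by auto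
  ultimately show ?thesis using square_hull[of x x' y y' v y] sq xy by auto
qed

end

section \<open>Growing a convex subgraph without separating cliques\<close>

definition no_separating_clique :: "('a \<times> 'a) set \<Rightarrow> 'a set \<Rightarrow> bool" where
  "no_separating_clique E H \<longleftrightarrow>
     (\<forall>C\<subseteq>H. (\<forall>u\<in>C. \<forall>v\<in>C. u \<noteq> v \<longrightarrow> (u, v) \<in> E) \<longrightarrow> conn_on E (H - C))"

lemma no_separating_cliqueD:
  "no_separating_clique E H \<Longrightarrow> C \<subseteq> H \<Longrightarrow> \<forall>u\<in>C. \<forall>v\<in>C. u \<noteq> v \<longrightarrow> (u, v) \<in> E \<Longrightarrow> conn_on E (H - C)"
  unfolding no_separating_clique_def by simp

lemma no_separating_clique_conn: "no_separating_clique E H \<Longrightarrow> conn_on E H"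
  unfolding no_separating_clique_def by (metis Diff_empty empty_iff empty_subsetI)

lemma no_separating_clique_conn_minus: "no_separating_clique E H \<Longrightarrow> r \<in> H \<Longrightarrow> conn_on E (H - {r})"
  unfolding no_separating_clique_def by (metis empty_subsetI insert_subset singletonD)

text \<open>
  A clique that avoids \<open>x\<close> cannot contain both \<open>a\<close> and \<open>b\<close>, hence \<open>x\<close> stays attached to the rest
  of \<open>H\<close>.
\<close>

lemma no_separating_clique_insert:
  assumes "sym E" "no_separating_clique E H" "a \<in> H" "b \<in> H" "a \<noteq> b" "(a, b) \<notin> E" "(x, a) \<in> E" "(x, b) \<in> E" "x \<notin> H"
  shows "no_separating_clique E (insert x H)"
  unfolding no_separating_clique_def
proof (intro allI impI)
  fix C assume C: "C \<subseteq> insert x H" "\<forall>u\<in>C. \<forall>v\<in>C. u \<noteq> v \<longrightarrow> (u, v) \<in> E"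
  show "conn_on E (insert x H - C)"
  proof (cases "x \<in> C")
    case True
    have "conn_on E (H - (C - {x}))" using assms(2) C unfolding no_separating_clique_def
      by (metis Diff_iff Diff_subset_conv insert_is_Un)
    moreover have "insert x H - C = H - (C - {x})" using True assms(9) by auto
    ultimately show ?thesis by simp
  next
    case False
    then have "conn_on E (H - C)" using assms(2) C unfolding no_separating_clique_def
      by (meson subset_insert)
    moreover obtain c where "c \<in> {a, b}" "c \<notin> C" using assms C by blast
    ultimately have "conn_on E (insert x (H - C))"
      using conn_on_insert[OF assms(1), of "H - C" c x] assms by auto
    moreover have "insert x H - C = insert x (H - C)" using False by auto
    ultimately show ?thesis by simp
  qed
qed

lemma no_separating_clique_square:
  assumes "sym E" "a \<noteq> b" "c \<noteq> d" "(a, b) \<notin> E" "(c, d) \<notin> E"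
    "(a, c) \<in> E" "(a, d) \<in> E" "(b, c) \<in> E" "(b, d) \<in> E"
  shows "no_separating_clique E {a, b, c, d}"
  unfolding no_separating_clique_def
proof (intro allI impI)
  fix C assume C: "C \<subseteq> {a, b, c, d}" "\<forall>u\<in>C. \<forall>v\<in>C. u \<noteq> v \<longrightarrow> (u, v) \<in> E"
  let ?H = "{a, b, c, d} - C"
  obtain s where s: "s \<in> {a, b}" "s \<in> ?H" using C assms by blast
  obtain t where t: "t \<in> {c, d}" "t \<in> ?H" using C assms by blast
  have E: "(p, q) \<in> E" "(q, p) \<in> E" if "p \<in> {a, b}" "q \<in> {c, d}" for p q
    using that assms by (auto dest: symD)
  show "conn_on E ?H"
  proof (rule conn_on_hub[OF assms(1)])
    fix u assume u: "u \<in> ?H"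
    have st: "(s, t) \<in> E \<inter> ?H \<times> ?H" using E[OF s(1) t(1)] s t by auto
    consider "u \<in> {a, b}" | "u \<in> {c, d}" using u by auto
    then show "(u, t) \<in> (E \<inter> ?H \<times> ?H)\<^sup>*"
    proof cases
      case 1
      then have "(u, t) \<in> E \<inter> ?H \<times> ?H" using E[OF 1 t(1)] u t by blast
      then show ?thesis by (rule r_into_rtrancl)
    next
      case 2
      then have "(u, s) \<in> E \<inter> ?H \<times> ?H" using E[OF s(1) 2] u s by blast
      then show ?thesis using st by (meson converse_rtrancl_into_rtrancl r_into_rtrancl)
    qed
  qed
qed

text \<open>
  There is a walk from \<open>a\<close> to \<open>b\<close> all of whose interior vertices lie in \<open>W\<close>: restricting only the
  targets of its steps leaves the starting vertex free.
\<close>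

definition outer_linked :: "('a \<times> 'a) set \<Rightarrow> 'a set \<Rightarrow> 'a \<Rightarrow> 'a \<Rightarrow> bool" where
  "outer_linked E W a b \<longleftrightarrow> (\<exists>q. (a, q) \<in> (E \<inter> UNIV \<times> W)\<^sup>* \<and> (q, b) \<in> E)"

lemma out_walk_rev:
  assumes "sym E" "(p, y) \<in> (E \<inter> UNIV \<times> W)\<^sup>*" "p \<in> W"
  shows "(y, p) \<in> (E \<inter> UNIV \<times> W)\<^sup>*"
proof -
  have "(p, y) \<in> (E \<inter> W \<times> W)\<^sup>* \<and> y \<in> W"
    using assms(2)
  proof induction
    case (step s t)
    then have "(s, t) \<in> E \<inter> W \<times> W" by auto
    then show ?case using step by (auto intro: rtrancl_into_rtrancl)
  qed (use assms(3) in auto)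
  then have "(y, p) \<in> (E \<inter> W \<times> W)\<^sup>*" using rtrancl_sym[OF sym_restrict[OF assms(1)]] by blast
  then show ?thesis by (rule rtrancl_mono[THEN subsetD, rotated]) auto
qed

lemma outer_meet:
  assumes "sym E" "(a, y) \<in> (E \<inter> UNIV \<times> W)\<^sup>*" "(b, y) \<in> (E \<inter> UNIV \<times> W)\<^sup>*" "b \<notin> W" "a \<noteq> b"
  shows "outer_linked E W a b"
  using assms(3)
proof (cases rule: converse_rtranclE)
  case base
  then show ?thesis using assms(2,4,5) by (auto elim: rtranclE)
next
  case (step c)
  then have "(y, c) \<in> (E \<inter> UNIV \<times> W)\<^sup>*" using out_walk_rev[OF assms(1)] by auto
  then have "(a, c) \<in> (E \<inter> UNIV \<times> W)\<^sup>*" using assms(2) by (rule rtrancl_trans[rotated])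
  then show ?thesis unfolding outer_linked_def using step assms(1) by (auto dest: symD)
qed

lemma out_walk_stays:
  assumes "(a, y) \<in> (E \<inter> UNIV \<times> W)\<^sup>*" "a \<in> M" "W \<subseteq> M"
  shows "(a, y) \<in> (E \<inter> M \<times> M)\<^sup>* \<and> y \<in> M"
  using assms(1)
proof induction
  case (step s t)
  then have "(s, t) \<in> E \<inter> M \<times> M" using assms(3) by auto
  then show ?case using step by (auto intro: rtrancl_into_rtrancl)
qed (use assms(2) in auto)

context relational_FIDL
begin

text \<open>
  The vertices of \<open>H\<close> adjacent to a component \<open>K\<close> of the complement of \<open>H\<close> do not form a clique, since
  such a clique would separate \<open>K\<close> from the rest of \<open>H\<close>.
\<close>

lemma outer_link_exists:
  assumes "no_separating_clique E V" "H \<subseteq> V" "H \<noteq> V" "\<not> (\<forall>u\<in>H. \<forall>v\<in>H. u \<noteq> v \<longrightarrow> (u, v) \<in> E)"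
  shows "\<exists>a\<in>H. \<exists>b\<in>H. a \<noteq> b \<and> (a, b) \<notin> E \<and> outer_linked E (V - H) a b"
proof -
  define A where "A = E \<inter> (V - H) \<times> (V - H)"
  have A_sym: "sym A" unfolding A_def by (rule sym_restrict[OF E_sym])
  obtain k where k: "k \<in> V" "k \<notin> H" using assms by auto
  define K where "K = {u. (k, u) \<in> A\<^sup>*}"
  have KV: "u \<in> V - H" if "u \<in> K" for u
    using that rtrancl_restrict_stays[of k u E "V - H"] k unfolding K_def A_def by auto
  define C where "C = {a \<in> H. \<exists>p\<in>K. (p, a) \<in> E}"
  have "\<not> (\<forall>u\<in>C. \<forall>v\<in>C. u \<noteq> v \<longrightarrow> (u, v) \<in> E)"
  proof
    assume clq: "\<forall>u\<in>C. \<forall>v\<in>C. u \<noteq> v \<longrightarrow> (u, v) \<in> E"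
    have "C \<subseteq> H" unfolding C_def by auto
    then have conn: "conn_on E (V - C)" using assms(1,2) clq by (intro no_separating_cliqueD) auto
    obtain h where h: "h \<in> H" "h \<notin> C" using assms(4) clq by metis
    have "k \<in> K" unfolding K_def by auto
    have kh: "(k, h) \<in> (E \<inter> (V - C) \<times> (V - C))\<^sup>*"
      using conn h k assms(2) \<open>C \<subseteq> H\<close> unfolding conn_on_def by blast
    have "h \<notin> K" using KV h by auto
    obtain p q where pq: "p \<in> K" "q \<notin> K" "(p, q) \<in> E \<inter> (V - C) \<times> (V - C)"
      using rtrancl_exit[OF kh \<open>k \<in> K\<close> \<open>h \<notin> K\<close>] by metis
    show False
    proof (cases "q \<in> H")
      case True then show False using pq unfolding C_def by auto
    next
      case False
      then have "(p, q) \<in> A" using pq KV unfolding A_def by auto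
      then show False using pq unfolding K_def by (auto intro: rtrancl_into_rtrancl)
    qed
  qed
  then obtain a b where ab: "a \<in> C" "b \<in> C" "a \<noteq> b" "(a, b) \<notin> E" by auto
  then obtain p q where pq: "p \<in> K" "q \<in> K" "(p, a) \<in> E" "(q, b) \<in> E" unfolding C_def by auto
  then have "(p, q) \<in> A\<^sup>*" unfolding K_def using rtrancl_sym[OF A_sym] by (auto intro: rtrancl_trans)
  then have "(p, q) \<in> (E \<inter> UNIV \<times> (V - H))\<^sup>*"
    by (rule rtrancl_mono[THEN subsetD, rotated]) (auto simp: A_def)
  moreover have "(a, p) \<in> E \<inter> UNIV \<times> (V - H)" using pq KV E_commute by auto
  ultimately have "outer_linked E (V - H) a b" unfolding outer_linked_def
    using pq by (meson converse_rtrancl_into_rtrancl)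
  then show ?thesis using ab unfolding C_def by blast
qed

text \<open>
  Choose a minimal convex \<open>W\<close> containing \<open>H\<close> such that two non-adjacent vertices \<open>a\<close>, \<open>b\<close> of \<open>H\<close> are
  joined by a walk with interior in \<open>W - H\<close>. Let \<open>x\<close> be any leaf of \<open>W\<close> outside \<open>H\<close>, and \<open>v\<close> its
  parent. By minimality every such walk visits \<open>x\<close>, arriving from some \<open>y\<close> and finally leaving to
  some \<open>z\<close>. Closing the walk inside \<open>H\<close> shows that \<open>xy\<close> and \<open>xz\<close> are no bridges, so \<open>v\<close> is adjacent
  to both and can replace \<open>x\<close> in the walk. By minimality \<open>v\<close> is then in \<open>H\<close>, and the two parts of
  the new walk, from \<open>a\<close> to \<open>v\<close> and from \<open>v\<close> to \<open>b\<close>, have adjacent ends. As \<open>v\<close> is adjacent to \<open>a\<close>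
  for every choice of the leaf, all leaves outside \<open>H\<close> have one colour, and hence so has \<open>W - H\<close>. No
  edge of the graph joins two vertices of that colour, so \<open>y = a\<close> and \<open>z = b\<close>.
\<close>

lemma convex_extension:
  assumes "no_separating_clique E V" "H \<subseteq> V" "H \<noteq> V" "convex_in L H" "conn_on E H"
    and p: "p \<in> H" "p' \<in> H" "(p, p') \<in> E"
    and nonclique: "\<not> (\<forall>u\<in>H. \<forall>v\<in>H. u \<noteq> v \<longrightarrow> (u, v) \<in> E)"
  obtains x v a b where "x \<in> V - H" "v \<in> H" "(x, v) \<in> L"
    "a \<in> H" "b \<in> H" "a \<noteq> b" "(a, b) \<notin> E" "(x, a) \<in> E" "(x, b) \<in> E"
proof -
  define linked where "linked W \<longleftrightarrow> (\<exists>a\<in>H. \<exists>b\<in>H. a \<noteq> b \<and> (a, b) \<notin> E \<and> outer_linked E (W - H) a b)" for W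
  define \<W> where "\<W> = {W. H \<subseteq> W \<and> W \<subseteq> V \<and> convex_in L W \<and> linked W}"
  have "V \<in> \<W>" using convex_V unfolding \<W>_def linked_def using outer_link_exists assms by auto
  moreover have "finite \<W>"
    by (rule finite_subset[of _ "Pow V"]) (use finite_V in \<open>auto simp: \<W>_def\<close>)
  ultimately obtain W where W: "W \<in> \<W>" and min: "\<And>W'. W' \<in> \<W> \<Longrightarrow> W' \<subseteq> W \<Longrightarrow> W' = W"
    using finite_has_minimal[of \<W>] by blast
  have WD: "H \<subseteq> W" "W \<subseteq> V" "convex_in L W" using W unfolding \<W>_def by auto
  obtain a b where ab: "a \<in> H" "b \<in> H" "a \<noteq> b" "(a, b) \<notin> E" "outer_linked E (W - H) a b"
    using W unfolding \<W>_def linked_def by auto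
  have leaf: "v \<in> H \<and> (a, v) \<in> E \<and> (b, v) \<in> E \<and>
      (\<exists>y z. (a, y) \<in> (E \<inter> UNIV \<times> (W - H))\<^sup>* \<and> (y, x) \<in> E \<and>
             (b, z) \<in> (E \<inter> UNIV \<times> (W - H))\<^sup>* \<and> (z, x) \<in> E)"
    if x: "x \<in> W - H" "convex_in L (W - {x})" "v \<in> W - {x}" "(x, v) \<in> L" for x v
  proof -
    define M where "M = W - {x}"
    define O' where "O' = M - H"
    have HM: "H \<subseteq> M" and MW: "W = insert x M" "x \<notin> M" using x WD unfolding M_def by auto
    have "\<not> linked M"
    proof
      assume "linked M"
      then have "M \<in> \<W>" using HM MW WD x unfolding \<W>_def M_def by auto
      then show False using min[of M] MW by auto
    qed
    then have unlinked: "p = q \<or> (p, q) \<in> E" if "p \<in> H" "q \<in> H" "outer_linked E O' p q" for p q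
      using that unfolding linked_def O'_def by auto
    \<comment> \<open>Otherwise \<open>a\<close> and \<open>b\<close> would be linked outside \<open>H\<close> without \<open>x\<close>, against minimality.\<close>
    have disjoint: False if "(a, y) \<in> (E \<inter> UNIV \<times> O')\<^sup>*" "(b, y) \<in> (E \<inter> UNIV \<times> O')\<^sup>*" for y
      using outer_meet[OF E_sym that] unlinked[OF ab(1,2)] ab unfolding O'_def by auto
    \<comment> \<open>\<open>y\<close> is the vertex before the first visit to \<open>x\<close>.\<close>
    have reach_x: "\<exists>y. (c, y) \<in> (E \<inter> UNIV \<times> O')\<^sup>* \<and> (y, x) \<in> E"
      if c: "outer_linked E (W - H) c d" "\<not> outer_linked E O' c d" for c d
    proof -
      obtain q where q: "(c, q) \<in> (E \<inter> UNIV \<times> (W - H))\<^sup>*" "(q, d) \<in> E"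
        using c unfolding outer_linked_def by auto
      let ?A = "{y. (c, y) \<in> (E \<inter> UNIV \<times> O')\<^sup>*}"
      have "q \<notin> ?A" using c q unfolding outer_linked_def by auto
      then obtain s t where st: "s \<in> ?A" "t \<notin> ?A" "(s, t) \<in> E \<inter> UNIV \<times> (W - H)"
        using rtrancl_exit[OF q(1), of ?A] by auto
      have "t \<notin> O'" using st by (auto intro: rtrancl_into_rtrancl)
      then have "t = x" using st MW unfolding O'_def by auto
      then show ?thesis using st by auto
    qed
    have ba: "outer_linked E (W - H) b a"
    proof -
      obtain q where q: "(a, q) \<in> (E \<inter> UNIV \<times> (W - H))\<^sup>*" "(q, b) \<in> E"
        using ab unfolding outer_linked_def by auto
      have "q \<noteq> a" using q ab by auto
      then have "q \<in> W - H" using q by (auto elim: rtranclE)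
      then have "(b, q) \<in> (E \<inter> UNIV \<times> (W - H))\<^sup>*" using q E_commute by auto
      then show ?thesis using outer_meet[OF E_sym _ q(1), of b] ab by auto
    qed
    obtain y where y: "(a, y) \<in> (E \<inter> UNIV \<times> O')\<^sup>*" "(y, x) \<in> E"
      using reach_x[OF ab(5)] unlinked ab by blast
    obtain z where z: "(b, z) \<in> (E \<inter> UNIV \<times> O')\<^sup>*" "(z, x) \<in> E"
      using reach_x[OF ba] unlinked[of b a] ab E_commute by blast
    have yz: "y \<noteq> z" using disjoint y z by auto
    have OM: "O' \<subseteq> M" unfolding O'_def by auto
    have yM: "(a, y) \<in> (E \<inter> M \<times> M)\<^sup>*" "y \<in> M" using out_walk_stays[OF y(1) _ OM] HM ab by auto
    have zM: "(b, z) \<in> (E \<inter> M \<times> M)\<^sup>*" "z \<in> M" using out_walk_stays[OF z(1) _ OM] HM ab by auto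
    have "(a, b) \<in> (E \<inter> H \<times> H)\<^sup>*" using assms(5) ab unfolding conn_on_def by auto
    then have "(a, b) \<in> (E \<inter> M \<times> M)\<^sup>*"
      by (rule rtrancl_mono[THEN subsetD, rotated]) (use HM in auto)
    then have walk: "(y, z) \<in> (E \<inter> M \<times> M)\<^sup>*"
      using rtrancl_sym[OF sym_restrict[OF E_sym] yM(1)] zM(1) by (meson rtrancl_trans)
    have "on_cycle E W x y" "on_cycle E W x z" unfolding MW(1)
      using on_cycle_through[OF MW(2) yz yM(2) zM(2)] on_cycle_through[OF MW(2) yz[symmetric] zM(2) yM(2)]
        walk rtrancl_sym[OF sym_restrict[OF E_sym] walk] E_commute[OF y(2)] E_commute[OF z(2)] by blast+
    then have vy: "(v, y) \<in> E" and vz: "(v, z) \<in> E"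
      using parent_dominates[OF WD(2,3) x(2,3,4)] by auto
    have vH: "v \<in> H"
    proof (rule ccontr)
      assume "v \<notin> H"
      then have "v \<in> O'" using x unfolding O'_def M_def by auto
      then have "(a, v) \<in> (E \<inter> UNIV \<times> O')\<^sup>*" "(b, v) \<in> (E \<inter> UNIV \<times> O')\<^sup>*"
        using y z vy vz E_commute by (auto intro: rtrancl_into_rtrancl)
      then show False using disjoint by auto
    qed
    have "outer_linked E O' a v" "outer_linked E O' b v" using y z vy vz E_commute unfolding outer_linked_def by blast+
    then have "(a, v) \<in> E" "(b, v) \<in> E" using unlinked[OF _ vH] ab E_commute by blast+
    moreover have "(E \<inter> UNIV \<times> O')\<^sup>* \<subseteq> (E \<inter> UNIV \<times> (W - H))\<^sup>*"
      by (rule rtrancl_mono) (auto simp: O'_def M_def)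
    ultimately show ?thesis using vH y z by blast
  qed
  have leaf_of: "\<exists>x v. x \<in> W - H \<and> (u, x) \<in> L\<^sup>* \<and> convex_in L (W - {x}) \<and> v \<in> W - {x} \<and> (x, v) \<in> L"
    if u: "u \<in> W - H" for u
  proof -
    have "\<exists>h\<in>H. (h, u) \<in> L\<^sup>*" using two_colours[OF p(3), of u] p u WD by auto
    then show ?thesis using leaf_outside[OF assms(4) WD(3,1,2) u] by metis
  qed
  obtain q where "(a, q) \<in> (E \<inter> UNIV \<times> (W - H))\<^sup>*" "(q, b) \<in> E" using ab unfolding outer_linked_def by auto
  then have "W - H \<noteq> {}" using ab by (auto elim: converse_rtranclE)
  then obtain x v where x: "x \<in> W - H" "convex_in L (W - {x})" "v \<in> W - {x}" "(x, v) \<in> L"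
    using leaf_of by blast
  obtain y z where vyz: "v \<in> H" "(a, v) \<in> E" "(b, v) \<in> E"
    "(a, y) \<in> (E \<inter> UNIV \<times> (W - H))\<^sup>*" "(y, x) \<in> E" "(b, z) \<in> (E \<inter> UNIV \<times> (W - H))\<^sup>*" "(z, x) \<in> E"
    using leaf[OF x] by auto
  \<comment> \<open>All of \<open>W - H\<close> has the colour of \<open>v\<close>: a leaf of the colour of \<open>u\<close> has a parent of that colour
    adjacent to \<open>a\<close>.\<close>
  have mono: "(v, u) \<in> L\<^sup>*" if u: "u \<in> W - H" for u
  proof -
    obtain x2 v2 where x2: "x2 \<in> W - H" "(u, x2) \<in> L\<^sup>*" "convex_in L (W - {x2})" "v2 \<in> W - {x2}" "(x2, v2) \<in> L"
      using leaf_of[OF u] by blast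
    then have "(a, v2) \<in> E" using leaf[of x2 v2] by auto
    then have "(v, v2) \<in> L\<^sup>*" using same_colour vyz(2) E_commute by blast
    moreover have "(v2, u) \<in> L\<^sup>*" using x2 Lstar_commute L_commute by (meson converse_rtrancl_into_rtrancl)
    ultimately show ?thesis by (rule rtrancl_trans)
  qed
  have "c = w" if "(c, w) \<in> (E \<inter> UNIV \<times> (W - H))\<^sup>*" "(w, x) \<in> E" for c w
  proof (rule ccontr)
    assume "c \<noteq> w"
    then have "w \<in> W - H" using that(1) by (auto elim: rtranclE)
    then have "(w, x) \<in> L\<^sup>*" using mono[of w] mono[of x] x Lstar_commute by (meson rtrancl_trans)
    then show False using E_colour that by auto
  qed
  then have "(a, x) \<in> E" "(b, x) \<in> E" using vyz by blast+
  then show thesis using that[of x v a b] x vyz ab WD E_commute by blast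
qed

end

context relational_FIDL
begin

text \<open>
  Deleting any vertex leaves the graph connected. Hence \<open>p\<close> has two neighbours \<open>r\<close> and \<open>s\<close>, and these
  are joined by a walk that avoids \<open>p\<close>.
\<close>

lemma edge_on_cycle:
  assumes "no_separating_clique E V" "p \<in> V" "q \<in> V" "p \<noteq> q" "(p, q) \<notin> E"
  obtains r where "on_cycle E V p r"
proof -
  have "(p, q) \<in> (E \<inter> V \<times> V)\<^sup>*" using no_separating_clique_conn[OF assms(1)] assms unfolding conn_on_def by auto
  then obtain r where r: "(p, r) \<in> E" using assms(4) by (auto elim: converse_rtranclE)
  have rV: "r \<in> V" "r \<noteq> p" "r \<noteq> q" using r E_V E_irrefl assms(5) by auto
  have "(p, q) \<in> (E \<inter> (V - {r}) \<times> (V - {r}))\<^sup>*"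
    using no_separating_clique_conn_minus[OF assms(1) rV(1)] assms rV unfolding conn_on_def by auto
  then obtain s where s: "(p, s) \<in> E" "s \<noteq> r" using assms(4) by (auto elim: converse_rtranclE)
  have sV: "s \<in> V" "s \<noteq> p" using s E_V E_irrefl by auto
  have "(s, r) \<in> (E \<inter> (V - {p}) \<times> (V - {p}))\<^sup>*"
    using no_separating_clique_conn_minus[OF assms(1,2)] sV rV unfolding conn_on_def by auto
  then have "on_cycle E (insert p (V - {p})) p r"
    using on_cycle_through[of p "V - {p}" r s E] r s rV sV by auto
  then show thesis using that assms(2) by (simp add: insert_absorb)
qed

text \<open>
  Any edge on a cycle lies in a square. By the square condition its diagonals \<open>{p,p'}\<close> and \<open>{r,r'}\<close>
  can be replaced by the first edges of the tree paths between their ends, and then the four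
  vertices form a convex set.
\<close>

lemma convex_square:
  assumes "no_separating_clique E V" "p \<in> V" "q \<in> V" "p \<noteq> q" "(p, q) \<notin> E"
  obtains a b c d where "(a, b) \<in> L" "(c, d) \<in> L"
    "(a, c) \<in> E" "(a, d) \<in> E" "(b, c) \<in> E" "(b, d) \<in> E"
proof -
  obtain r where cyc: "on_cycle E V p r" using edge_on_cycle[OF assms] .
  then have pr: "(p, r) \<in> E" unfolding on_cycle_def by auto
  obtain p' r' where sq: "p' \<noteq> p" "r' \<noteq> r" "(p, r') \<in> E" "(p', r) \<in> E" "(p', r') \<in> E"
    using cycle_square[OF subset_refl convex_V cyc] by auto
  obtain b where b: "(p, b) \<in> L" "b \<in> hull_in V L {p, p'}"
    using neighbour_towards[of p p'] sq same_colour[OF pr sq(4)] by metis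
  obtain d where d: "(r, d) \<in> L" "d \<in> hull_in V L {r, r'}"
    using neighbour_towards[of r r'] sq same_colour[of r p r'] pr E_commute by metis
  have in_hull: "p \<in> hull_in V L {p, p'}" "r \<in> hull_in V L {r, r'}"
    unfolding hull_in_def by auto
  have "(e, f) \<in> E" if "e \<in> hull_in V L {p, p'}" "f \<in> hull_in V L {r, r'}" for e f
    using square_hull[of p p' r r' e f] sq pr that by auto
  then show thesis using that[of p b r d] b d pr in_hull by blast
qed

lemma adjacent_pair_convex:
  assumes "(a, b) \<in> L" "(c, d) \<in> L" "(a, c) \<in> E" "(a, d) \<in> E" "(b, c) \<in> E" "(b, d) \<in> E"
  shows "convex_in L {a, b, c, d}"
  unfolding convex_in_def
proof (intro ballI impI)
  fix u w assume uw: "u \<in> {a, b, c, d}" "w \<in> {a, b, c, d}" "(u, w) \<in> L\<^sup>*"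
  have diff: "(s, t) \<notin> L\<^sup>*" "(t, s) \<notin> L\<^sup>*" if "s \<in> {a, b}" "t \<in> {c, d}" for s t
    using that assms E_colour Lstar_commute by blast+
  have "u = w \<or> (u, w) \<in> {(a, b), (b, a), (c, d), (d, c)}"
    using uw diff by blast
  then have "u = w \<or> (u, w) \<in> L \<inter> {a, b, c, d} \<times> {a, b, c, d}"
    using assms L_commute by blast
  then show "(u, w) \<in> (L \<inter> {a, b, c, d} \<times> {a, b, c, d})\<^sup>*" by auto
qed

text \<open>
  The last conjunct ensures that \<open>H\<close> meets both trees.
\<close>

definition inseparable_convex :: "'a set \<Rightarrow> bool" where
  "inseparable_convex H \<longleftrightarrow> H \<subseteq> V \<and> convex_in L H \<and> no_separating_clique E H \<and>
     \<not> (\<forall>u\<in>H. \<forall>v\<in>H. u \<noteq> v \<longrightarrow> (u, v) \<in> E) \<and> (\<exists>p\<in>H. \<exists>q\<in>H. (p, q) \<in> E)"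

definition grows_by :: "'a set \<Rightarrow> 'a \<Rightarrow> 'a \<Rightarrow> bool" where
  "grows_by H x v \<longleftrightarrow> x \<in> V - H \<and> v \<in> H \<and> (x, v) \<in> L \<and> inseparable_convex (insert x H) \<and>
     (\<forall>y\<in>H. (x, y) \<in> E \<longrightarrow> (v, y) \<in> E)"

lemma convex_subgraph_grows:
  assumes "no_separating_clique E V" "inseparable_convex H" "H \<noteq> V"
  shows "\<exists>x v. grows_by H x v"
proof -
  have H: "H \<subseteq> V" "convex_in L H" "no_separating_clique E H" "\<not> (\<forall>u\<in>H. \<forall>v\<in>H. u \<noteq> v \<longrightarrow> (u, v) \<in> E)"
    and "\<exists>p\<in>H. \<exists>q\<in>H. (p, q) \<in> E" using assms(2) unfolding inseparable_convex_def by auto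
  then obtain p q where pq: "p \<in> H" "q \<in> H" "(p, q) \<in> E" by auto
  obtain x v a b where x: "x \<in> V - H" "v \<in> H" "(x, v) \<in> L"
    "a \<in> H" "b \<in> H" "a \<noteq> b" "(a, b) \<notin> E" "(x, a) \<in> E" "(x, b) \<in> E"
    using convex_extension[OF assms(1) H(1) assms(3) H(2) no_separating_clique_conn[OF H(3)] pq H(4)] .
  let ?W = "insert x H"
  have W: "?W \<subseteq> V" "convex_in L ?W" "?W - {x} = H"
    using x H convex_insert[OF L_sym H(2) x(2,3)] by auto
  have "no_separating_clique E ?W"
    using no_separating_clique_insert[OF E_sym H(3) x(4-9)] x by auto
  then have "inseparable_convex ?W" using W pq x unfolding inseparable_convex_def by blast
  moreover have "(v, y) \<in> E" if y: "y \<in> H" "(x, y) \<in> E" for y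
  proof -
    obtain z where z: "z \<in> H" "(x, z) \<in> E" "y \<noteq> z" using x by metis
    have "(z, y) \<in> (E \<inter> H \<times> H)\<^sup>*" using no_separating_clique_conn[OF H(3)] z y unfolding conn_on_def by auto
    then have "on_cycle E ?W x y" using on_cycle_through[of x H y z] x y z by auto
    then show ?thesis using parent_dominates[OF W(1,2), of x v y] W(3) H x by auto
  qed
  ultimately show ?thesis using x unfolding grows_by_def by blast
qed

lemma dismantling_exists:
  assumes "no_separating_clique E V" "p \<in> V" "q \<in> V" "p \<noteq> q" "(p, q) \<notin> E"
  obtains n h x v a b c d where
    "h n = V" "h 0 = {a, b, c, d}" "(a, b) \<in> L" "(c, d) \<in> L"
    "(a, c) \<in> E" "(a, d) \<in> E" "(b, c) \<in> E" "(b, d) \<in> E"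
    "\<And>i. i \<le> n \<Longrightarrow> h i \<subseteq> V \<and> no_separating_clique E (h i) \<and> \<not> (\<forall>u\<in>h i. \<forall>v\<in>h i. u \<noteq> v \<longrightarrow> (u, v) \<in> E)"
    "\<And>i. i < n \<Longrightarrow> x (Suc i) \<notin> h i \<and> h (Suc i) = insert (x (Suc i)) (h i) \<and> v i \<in> h i \<and>
        (\<forall>y\<in>h i. (x (Suc i), y) \<in> E \<longrightarrow> (v i, y) \<in> E)"
    "\<And>i j z. i < j \<Longrightarrow> j < n \<Longrightarrow> z \<in> h i \<Longrightarrow> (x (Suc j), x (Suc i)) \<in> E \<Longrightarrow> (x (Suc j), z) \<in> E \<Longrightarrow>
        (x (Suc j), v i) \<in> E"
proof -
  obtain a b c d where sq: "(a, b) \<in> L" "(c, d) \<in> L"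
    "(a, c) \<in> E" "(a, d) \<in> E" "(b, c) \<in> E" "(b, d) \<in> E"
    using convex_square[OF assms] .
  define H0 where "H0 = {a, b, c, d}"
  have ab: "a \<noteq> b" "c \<noteq> d" using sq L_irrefl by auto
  have nE: "(a, b) \<notin> E" "(c, d) \<notin> E" using sq E_colour by blast+
  have "inseparable_convex H0"
    unfolding inseparable_convex_def H0_def
    using sq ab nE E_V adjacent_pair_convex[OF sq] no_separating_clique_square[OF E_sym ab nE sq(3-6)] by blast
  obtain fx fv where step: "\<And>H. inseparable_convex H \<Longrightarrow> H \<noteq> V \<Longrightarrow> grows_by H (fx H) (fv H)"
    using convex_subgraph_grows[OF assms(1)] by metis
  define h where "h = rec_nat H0 (\<lambda>_ H. insert (fx H) H)"
  have h0: "h 0 = H0" and hS: "h (Suc i) = insert (fx (h i)) (h i)" for i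
    unfolding h_def by simp_all
  define n where "n = card V - card H0"
  have H0V: "card H0 \<le> card V" "finite H0"
    using \<open>inseparable_convex H0\<close> finite_V finite_subset unfolding inseparable_convex_def by (auto intro: card_mono)
  have grow: "inseparable_convex (h i) \<and> card (h i) = card H0 + i" if "i \<le> n" for i
    using that
  proof (induction i)
    case 0 then show ?case using \<open>inseparable_convex H0\<close> h0 by simp
  next
    case (Suc i)
    then have i: "inseparable_convex (h i)" "card (h i) = card H0 + i" "h i \<noteq> V" using H0V unfolding n_def by auto
    then have "grows_by (h i) (fx (h i)) (fv (h i))" using step by auto
    then show ?case using i finite_V finite_subset[of "h i" V] unfolding hS grows_by_def inseparable_convex_def by auto
  qed
  have hn: "h n = V"
    using grow[of n] H0V finite_V unfolding inseparable_convex_def n_def by (intro card_subset_eq) auto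
  have grows: "grows_by (h i) (fx (h i)) (fv (h i))" if "i < n" for i
  proof -
    have "h i \<noteq> V" using grow[of i] that H0V unfolding n_def by auto
    then show ?thesis using step grow[of i] that by auto
  qed
  have h_mono: "h i \<subseteq> h j" if "i \<le> j" for i j
    using that by (induction rule: dec_induct) (auto simp: hS)
  define x where "x = (\<lambda>k. fx (h (k - 1)))"
  define v where "v = (\<lambda>i. fv (h i))"
  have xS: "x (Suc i) = fx (h i)" for i unfolding x_def by simp
  \<comment> \<open>The vertices \<open>x (Suc j)\<close>, \<open>v j\<close> and \<open>x (Suc i)\<close>, \<open>z\<close> are the diagonals of a square, and \<open>v i\<close> is
    on the tree path from \<open>x (Suc i)\<close> to \<open>z\<close>.\<close>
  have cond: "(x (Suc j), v i) \<in> E"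
    if ij: "i < j" "j < n" and z: "z \<in> h i" and e: "(x (Suc j), x (Suc i)) \<in> E" "(x (Suc j), z) \<in> E" for i j z
  proof -
    have gi: "grows_by (h i) (x (Suc i)) (v i)" and gj: "grows_by (h j) (x (Suc j)) (v j)"
      using grows[of i] grows[of j] ij unfolding xS v_def by auto
    have hij: "h (Suc i) \<subseteq> h j" using h_mono[of "Suc i" j] ij by auto
    have x_new: "x (Suc i) \<notin> h i" "x (Suc j) \<notin> h j" using gi gj unfolding grows_by_def by auto
    have xi: "x (Suc i) \<in> h j" "z \<in> h j" using hij z unfolding hS xS by auto
    have vj: "(v j, x (Suc i)) \<in> E" "(v j, z) \<in> E" "v j \<in> h j" using gj xi e unfolding grows_by_def by auto
    have cvx: "convex_in L (h i)" using grow[of i] ij unfolding inseparable_convex_def by auto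
    have "(x (Suc i), z) \<in> L\<^sup>*" using same_colour e E_commute by blast
    then have "v i \<in> hull_in V L {x (Suc i), z}"
      using parent_in_hull[OF cvx x_new(1), of "v i" z] gi z unfolding grows_by_def by auto
    moreover have "x (Suc j) \<in> hull_in V L {x (Suc j), v j}" unfolding hull_in_def by auto
    moreover have "x (Suc i) \<noteq> z" "x (Suc j) \<noteq> v j" using x_new z vj by auto
    ultimately show ?thesis
      using square_hull[of "x (Suc j)" "v j" "x (Suc i)" z "x (Suc j)" "v i"] e vj by auto
  qed
  show thesis
  proof (rule that[of h n a b c d x v])
    show "h n = V" by (rule hn)
    show "h 0 = {a, b, c, d}" using h0 H0_def by simp
    show "h i \<subseteq> V \<and> no_separating_clique E (h i) \<and> \<not> (\<forall>u\<in>h i. \<forall>v\<in>h i. u \<noteq> v \<longrightarrow> (u, v) \<in> E)" if "i \<le> n" for i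
      using grow[OF that] unfolding inseparable_convex_def by blast
    show "x (Suc i) \<notin> h i \<and> h (Suc i) = insert (x (Suc i)) (h i) \<and> v i \<in> h i \<and>
        (\<forall>y\<in>h i. (x (Suc i), y) \<in> E \<longrightarrow> (v i, y) \<in> E)" if "i < n" for i
      using grows[OF that] unfolding xS v_def hS grows_by_def by auto
  qed (use sq cond in auto)
qed

end

section \<open>Attaching leaves\<close>

text \<open>
  Convexity of all links implies the square condition and, unlike it, is easily checked when a leaf
  is attached.
\<close>

locale link_convex_forest = two_coloured_forest +
  assumes links_convex: "a \<in> V \<Longrightarrow> convex_in L {u. (a, u) \<in> E}"
    and cycle_square: "H \<subseteq> V \<Longrightarrow> convex_in L H \<Longrightarrow> on_cycle E H a b \<Longrightarrow>
     \<exists>a'\<in>H. \<exists>b'\<in>H. a' \<noteq> a \<and> b' \<noteq> b \<and> (a, b') \<in> E \<and> (a', b) \<in> E \<and> (a', b') \<in> E"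
begin

lemma hull_in_link:
  assumes "(c, a) \<in> E" "(c, b) \<in> E" "e \<in> hull_in V L {a, b}" shows "(c, e) \<in> E"
proof -
  have "{u. (c, u) \<in> E} \<subseteq> V" "convex_in L {u. (c, u) \<in> E}"
    using assms E_V links_convex by auto
  then have "e \<in> {u. (c, u) \<in> E}" using assms unfolding hull_in_def by blast
  then show ?thesis by simp
qed

sublocale relational_FIDL
proof unfold_locales
  fix a b c d e f
  assume E: "(a, c) \<in> E" "(a, d) \<in> E" "(b, c) \<in> E" "(b, d) \<in> E"
    and ef: "e \<in> hull_in V L {a, b}" "f \<in> hull_in V L {c, d}"
  then have "(e, c) \<in> E" "(e, d) \<in> E" using hull_in_link E_commute by blast+
  then show "(e, f) \<in> E" using hull_in_link ef by blast
qed (rule cycle_square)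

end

text \<open>
  Each tree is a single edge here, so \<open>L\<close> together with the identity is transitive and all sets are
  convex.
\<close>

lemma square_forest:
  assumes "distinct [a, b, c, d]"
  defines "E \<equiv> {a, b} \<times> {c, d} \<union> {c, d} \<times> {a, b}" and "L \<equiv> {(a, b), (b, a), (c, d), (d, c)}"
  shows "link_convex_forest {a, b, c, d} E L" and "convex_in L H"
proof -
  have star: "p = q \<or> (p, q) \<in> M" if "(p, q) \<in> M\<^sup>*" "M \<subseteq> L" for p q M
    using that(1)
  proof induction
    case (step s t)
    then show ?case using that(2) assms(1) unfolding L_def by auto
  qed auto
  show convex: "convex_in L H" for H
    unfolding convex_in_def
  proof (intro ballI impI)
    fix u w assume "u \<in> H" "w \<in> H" "(u, w) \<in> L\<^sup>*"
    then have "u = w \<or> (u, w) \<in> L \<inter> H \<times> H" using star[of u w L] by auto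
    then show "(u, w) \<in> (L \<inter> H \<times> H)\<^sup>*" by auto
  qed
  show "link_convex_forest {a, b, c, d} E L"
  proof unfold_locales
    show "(u, v) \<notin> (L - {(u, v), (v, u)})\<^sup>*" if "(u, v) \<in> L" for u v
      using star[of u v "L - {(u, v), (v, u)}"] that assms(1) unfolding L_def by auto
    show "(u, v) \<notin> L\<^sup>*" if "(u, v) \<in> E" for u v
      using star[of u v L] that assms(1) unfolding L_def E_def by auto
    show "(u, w) \<in> L\<^sup>* \<or> (v, w) \<in> L\<^sup>*" if uv: "(u, v) \<in> E" and w: "w \<in> {a, b, c, d}" for u v w
    proof -
      have "(u, w) \<in> L \<or> u = w \<or> (v, w) \<in> L \<or> v = w"
        using uv w unfolding E_def L_def by auto
      then show ?thesis by auto
    qed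
    show "\<exists>a'\<in>H. \<exists>b'\<in>H. a' \<noteq> p \<and> b' \<noteq> q \<and> (p, b') \<in> E \<and> (a', q) \<in> E \<and> (a', b') \<in> E"
      if "on_cycle E H p q" for H p q
    proof -
      let ?A = "E \<inter> H \<times> H - {(p, q), (q, p)}"
      have pq: "(p, q) \<in> E" "(p, q) \<in> ?A\<^sup>*" using that unfolding on_cycle_def by auto
      have "p \<noteq> q" using pq assms(1) unfolding E_def by auto
      \<comment> \<open>The first and the last step of a walk from \<open>p\<close> to \<open>q\<close> that avoids the edge \<open>pq\<close> already provide the
        two other corners.\<close>
      then obtain b' where b': "(p, b') \<in> ?A" using pq by (auto elim: converse_rtranclE)
      obtain a' where a': "(a', q) \<in> ?A" using \<open>p \<noteq> q\<close> pq by (auto elim: rtranclE)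
      have "(a', b') \<in> E" using a' b' pq(1) assms(1) unfolding E_def by auto
      then show ?thesis using a' b' by blast
    qed
    show "sym E" "sym L" unfolding E_def L_def sym_def by auto
  qed (use convex in \<open>auto simp: E_def L_def\<close>)
qed

lemma convex_attach_leaf:
  assumes "convex_in L H" "x \<notin> H"
    and map: "\<And>p q. (p, q) \<in> L'\<^sup>* \<Longrightarrow> p \<noteq> x \<Longrightarrow> q \<noteq> x \<Longrightarrow> (p, q) \<in> L\<^sup>*" and "L \<subseteq> L'"
  shows "convex_in L' H"
  unfolding convex_in_def
proof (intro ballI impI)
  fix u w assume "u \<in> H" "w \<in> H" "(u, w) \<in> L'\<^sup>*"
  then have "(u, w) \<in> (L \<inter> H \<times> H)\<^sup>*" using assms unfolding convex_in_def by metis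
  then show "(u, w) \<in> (L' \<inter> H \<times> H)\<^sup>*"
    by (rule rtrancl_mono[THEN subsetD, rotated]) (use assms(4) in auto)
qed

context two_coloured_forest
begin

text \<open>
  The map that sends the new leaf \<open>x\<close> to its parent \<open>v\<close> collapses the new edge.
\<close>

lemma attach_leaf_map:
  assumes "(p, q) \<in> (insert (x, v) (insert (v, x) L))\<^sup>*" "x \<notin> V" "v \<in> V"
  shows "(if p = x then v else p, if q = x then v else q) \<in> L\<^sup>*"
  using assms(1)
proof (rule rtrancl_map)
  fix s t assume "(s, t) \<in> insert (x, v) (insert (v, x) L)"
  moreover have "x \<noteq> v" using assms by auto
  ultimately show "(if s = x then v else s, if t = x then v else t) \<in> L\<^sup>*"
    using L_V assms(2) by auto
qed

lemma attach_leaf_convex: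
  assumes "x \<notin> V" "v \<in> V" "convex_in L H" "H \<subseteq> V"
  defines "L' \<equiv> insert (x, v) (insert (v, x) L)"
  shows "convex_in L' H" and "v \<in> H \<Longrightarrow> convex_in L' (insert x H)"
proof -
  show H: "convex_in L' H"
    by (rule convex_attach_leaf[OF assms(3), of x])
      (use assms attach_leaf_map[of _ _ x v] in \<open>force simp: L'_def\<close>)+
  have "sym L'" using L_sym unfolding L'_def sym_def by auto
  then show "convex_in L' (insert x H)" if "v \<in> H"
    using convex_insert[OF _ H that, of x] unfolding L'_def by auto
qed

end

context link_convex_forest
begin

text \<open>
  Let \<open>f\<close> send \<open>x\<close> to \<open>v\<close> and fix all other vertices. As the neighbours of \<open>x\<close> are also neighbours of
  \<open>v\<close>, \<open>f\<close> maps the new edges to old ones, both in the graph and, up to collapsing \<open>xv\<close>, in the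
  forest. This transfers bridges and colours. The link of \<open>x\<close> is \<open>N\<close>, and a link that gains \<open>x\<close>
  already contains \<open>v\<close>, so links stay convex. For the cycle condition, the walk around an edge
  \<open>ab\<close> without end \<open>x\<close> is mapped to one that avoids \<open>x\<close>; it may newly use the edge \<open>ab\<close> only if \<open>ab\<close>
  joins \<open>v\<close> to an element of \<open>N\<close>, and then either there is an evident square or \<open>x\<close> has only one
  neighbour in \<open>H\<close>, onto which it can be folded. An edge with end \<open>x\<close> has an evident square with
  \<open>v\<close> as the fourth corner.
\<close>

lemma attach_leaf:
  assumes x: "x \<notin> V" and v: "v \<in> V" and N: "N \<subseteq> {u. (v, u) \<in> E}" "convex_in L N"
  shows "link_convex_forest (insert x V) (E \<union> ({x} \<times> N \<union> N \<times> {x})) (insert (x, v) (insert (v, x) L))"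
proof -
  define E' where "E' = E \<union> ({x} \<times> N \<union> N \<times> {x})"
  define L' where "L' = insert (x, v) (insert (v, x) L)"
  define f where "f = (\<lambda>u. if u = x then v else u)"
  have NV: "N \<subseteq> V" using N E_V by auto
  have f_V: "f u = u" if "u \<in> V" for u using that x unfolding f_def by auto
  have f_in: "f u \<in> V" if "u \<in> insert x V" for u using that v unfolding f_def by auto
  have L'_map: "(f p, f q) \<in> L\<^sup>*" if "(p, q) \<in> L'\<^sup>*" for p q
    using attach_leaf_map[of p q x v] that x v unfolding L'_def f_def by auto
  have mono: "L\<^sup>* \<subseteq> L'\<^sup>*" unfolding L'_def by (rule rtrancl_mono) auto
  have E'_map: "(f p, f q) \<in> E" if pq: "(p, q) \<in> E'" for p q
  proof -
    consider "(p, q) \<in> E" | "p = x" "q \<in> N" | "p \<in> N" "q = x" using pq unfolding E'_def by auto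
    then show ?thesis
    proof cases
      case 1 then show ?thesis using f_V E_V by auto
    next
      case 2 then show ?thesis using f_V NV N x unfolding f_def by auto
    next
      case 3 then show ?thesis using f_V NV N x E_commute unfolding f_def by auto
    qed
  qed
  have to_f: "(p, f p) \<in> L'\<^sup>*" "(f p, p) \<in> L'\<^sup>*" for p unfolding f_def L'_def by auto
  have E'_sym: "sym E'" using E_sym unfolding E'_def sym_def by auto
  have L'_sym: "sym L'" using L_sym unfolding L'_def sym_def by auto
  interpret ext: two_coloured_forest "insert x V" E' L'
  proof unfold_locales
    show "finite (insert x V)" using finite_V by simp
    show "E' \<subseteq> insert x V \<times> insert x V" using E_sub NV unfolding E'_def by auto
    show "L' \<subseteq> insert x V \<times> insert x V" using L_sub v unfolding L'_def by auto
    show "(p, q) \<notin> (L' - {(p, q), (q, p)})\<^sup>*" if pq: "(p, q) \<in> L'" for p q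
    proof
      assume path: "(p, q) \<in> (L' - {(p, q), (q, p)})\<^sup>*"
      show False
      proof (cases "(p, q) \<in> L")
        case True
        have "(f p, f q) \<in> (L - {(p, q), (q, p)})\<^sup>*"
        proof (rule rtrancl_map[OF path])
          fix s t assume st: "(s, t) \<in> L' - {(p, q), (q, p)}"
          show "(f s, f t) \<in> (L - {(p, q), (q, p)})\<^sup>*"
          proof (cases "(s, t) \<in> L")
            case True
            then show ?thesis using st f_V L_V by auto
          next
            case False
            then have "f s = f t" using st f_V[OF v] unfolding L'_def f_def by auto
            then show ?thesis by simp
          qed
        qed
        then show False using True L_bridge f_V L_V by auto
      next
        case False
        then have "L' - {(p, q), (q, p)} \<subseteq> L" "p = x \<and> q = v \<or> p = v \<and> q = x"
          using pq unfolding L'_def by auto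
        then have "(p, q) \<in> L\<^sup>*" "p = x \<and> q = v \<or> p = v \<and> q = x"
          using path rtrancl_mono by blast+
        moreover have "(x, v) \<notin> L\<^sup>*" using x v L_V by (auto elim: converse_rtranclE)
        ultimately show False using Lstar_commute by blast
      qed
    qed
    show "(p, q) \<notin> L'\<^sup>*" if "(p, q) \<in> E'" for p q
      using E'_map[OF that] L'_map E_colour by blast
    show "(p, w) \<in> L'\<^sup>* \<or> (q, w) \<in> L'\<^sup>*" if "(p, q) \<in> E'" "w \<in> insert x V" for p q w
    proof -
      have "(f p, f w) \<in> L'\<^sup>* \<or> (f q, f w) \<in> L'\<^sup>*"
        using two_colours[OF E'_map[OF that(1)] f_in[OF that(2)]] mono by auto
      then show ?thesis using to_f by (meson rtrancl_trans)
    qed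
  qed (fact E'_sym L'_sym)+
  have "link_convex_forest (insert x V) E' L'"
  proof unfold_locales
    fix a assume a: "a \<in> insert x V"
    consider "a = x" | "a \<noteq> x" "a \<in> N" | "a \<noteq> x" "a \<notin> N" by auto
    then show "convex_in L' {u. (a, u) \<in> E'}"
    proof cases
      case 1
      then have "{u. (a, u) \<in> E'} = N" using x E_V NV unfolding E'_def by auto
      then show ?thesis using attach_leaf_convex(1)[OF x v N(2) NV] unfolding L'_def by simp
    next
      case 2
      then have "{u. (a, u) \<in> E'} = insert x {u. (a, u) \<in> E}" unfolding E'_def by auto
      moreover have "v \<in> {u. (a, u) \<in> E}" using 2 N E_commute by auto
      moreover have "{u. (a, u) \<in> E} \<subseteq> V" using E_V by auto
      ultimately show ?thesis
        using attach_leaf_convex(2)[OF x v links_convex[of a]] a 2 unfolding L'_def by auto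
    next
      case 3
      then have "{u. (a, u) \<in> E'} = {u. (a, u) \<in> E}" unfolding E'_def by auto
      moreover have "{u. (a, u) \<in> E} \<subseteq> V" using E_V by auto
      ultimately show ?thesis
        using attach_leaf_convex(1)[OF x v links_convex[of a]] a 3 unfolding L'_def by auto
    qed
  next
    fix H a b
    assume H: "H \<subseteq> insert x V" "convex_in L' H" and cyc: "on_cycle E' H a b"
    define M where "M = H - {x}"
    have MV: "M \<subseteq> V" using H unfolding M_def by auto
    have M_convex: "convex_in L M"
      unfolding convex_in_def
    proof (intro ballI impI)
      fix u w assume uw: "u \<in> M" "w \<in> M" "(u, w) \<in> L\<^sup>*"
      then have "(u, w) \<in> (L' \<inter> H \<times> H)\<^sup>*"
        using H mono unfolding convex_in_def M_def by blast
      then have "(f u, f w) \<in> (L \<inter> M \<times> M)\<^sup>*"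
      proof (rule rtrancl_map)
        fix s t assume st: "(s, t) \<in> L' \<inter> H \<times> H"
        show "(f s, f t) \<in> (L \<inter> M \<times> M)\<^sup>*"
        proof (cases "(s, t) \<in> L")
          case True
          then have "(s, t) \<in> L \<inter> M \<times> M" using st L_V x unfolding M_def by auto
          moreover from this have "s \<in> V" "t \<in> V" using MV by auto
          ultimately show ?thesis using f_V by (metis r_into_rtrancl)
        next
          case False
          then have "f s = f t" using st f_V[OF v] unfolding L'_def f_def by auto
          then show ?thesis by simp
        qed
      qed
      then show "(u, w) \<in> (L \<inter> M \<times> M)\<^sup>*" using uw MV f_V by (metis subsetD)
    qed
    have parent: "v \<in> H" if xw: "x \<in> H" "w \<in> H" "w \<noteq> x" "(x, w) \<in> L'\<^sup>*" for w
    proof -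
      have "(x, w) \<in> (L' \<inter> H \<times> H)\<^sup>*" using H xw unfolding convex_in_def by auto
      then obtain y where "(x, y) \<in> L' \<inter> H \<times> H" using rtrancl_first_step xw(3) by metis
      then show ?thesis using L_V x unfolding L'_def by auto
    qed
    \<comment> \<open>The condition is symmetric in \<open>a\<close> and \<open>b\<close>, so \<open>b\<close> may be assumed different from \<open>x\<close>.\<close>
    have main: "\<exists>a'\<in>H. \<exists>b'\<in>H. a' \<noteq> a \<and> b' \<noteq> b \<and> (a, b') \<in> E' \<and> (a', b) \<in> E' \<and> (a', b') \<in> E'"
      if cyc: "on_cycle E' H a b" and bx: "b \<noteq> x" for a b
    proof -
      let ?A = "E' \<inter> H \<times> H - {(a, b), (b, a)}"
      have ab: "(a, b) \<in> E'" "a \<in> H" "b \<in> H" "(a, b) \<in> ?A\<^sup>*" using cyc unfolding on_cycle_def by auto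
      have "a \<noteq> b" using ab ext.E_irrefl by auto
      have EE': "E \<subseteq> E'" unfolding E'_def by auto
      \<comment> \<open>A map \<open>g\<close> that pushes the walk into \<open>M\<close> reduces the claim to the graph without \<open>x\<close>.\<close>
      have descend: ?thesis if g: "\<And>s t. (s, t) \<in> ?A \<Longrightarrow> (g s, g t) \<in> (E \<inter> M \<times> M - {(a, b), (b, a)})\<^sup>*"
        and gab: "g a = a" "g b = b" and ax: "a \<noteq> x" for g
      proof -
        have "(g a, g b) \<in> (E \<inter> M \<times> M - {(a, b), (b, a)})\<^sup>*" using rtrancl_map[OF ab(4) g] .
        moreover have "(a, b) \<in> E \<inter> M \<times> M" using ab ax bx unfolding E'_def M_def by auto
        ultimately have "on_cycle E M a b" using gab unfolding on_cycle_def by auto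
        then obtain a' b' where "a' \<in> M" "b' \<in> M" "a' \<noteq> a" "b' \<noteq> b" "(a, b') \<in> E" "(a', b) \<in> E" "(a', b') \<in> E"
          using cycle_square[OF MV M_convex] by blast
        then show ?thesis using EE' unfolding M_def by blast
      qed
      have in_N: "y \<in> N" "(v, y) \<in> E" "(y, v) \<in> E" if "(x, y) \<in> E' \<or> (y, x) \<in> E'" for y
        using that x E_V N E_commute unfolding E'_def by auto
      show ?thesis
      proof (cases "a = x")
        case True
        obtain y where y: "(x, y) \<in> ?A" using rtrancl_first_step[OF ab(4) \<open>a \<noteq> b\<close>] True by metis
        obtain z where z: "(z, b) \<in> ?A" using rtrancl_last_step[OF ab(4) \<open>a \<noteq> b\<close>] by metis
        have "(x, z) \<in> L'\<^sup>*" using ext.same_colour ab(1) z True by blast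
        then have "v \<in> H" using parent[of z] z ab True by auto
        moreover have "(v, b) \<in> E" "(v, y) \<in> E" using in_N ab(1) y True by auto
        moreover have "y \<noteq> b" "v \<noteq> x" using y True x v by auto
        ultimately show ?thesis using y True EE' by blast
      next
        case ax: False
        show ?thesis
        proof (cases "x \<in> H")
          case False
          have "(s, t) \<in> (E \<inter> M \<times> M - {(a, b), (b, a)})\<^sup>*" if "(s, t) \<in> ?A" for s t
            using that False unfolding E'_def M_def by auto
          then show ?thesis using descend[of id] ax by auto
        next
          case xH: True
          have "(a, x) \<in> L'\<^sup>* \<or> (b, x) \<in> L'\<^sup>*" using ext.two_colours[OF ab(1), of x] by auto
          then have vH: "v \<in> H"
            using parent[of a] parent[of b] ab ax bx xH ext.Lstar_commute by blast
          have vM: "v \<in> M" using vH v x unfolding M_def by auto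
          show ?thesis
          proof (cases "\<exists>y\<in>N \<inter> H. {a, b} = {v, y}")
            case False
            have f_step: "(f s, f t) \<in> (E \<inter> M \<times> M - {(a, b), (b, a)})\<^sup>*" if st: "(s, t) \<in> ?A" for s t
            proof -
              have "f s \<in> M" "f t \<in> M" using st vM unfolding f_def M_def by auto
              moreover have "(f s, f t) \<in> E" using E'_map st by auto
              moreover have "(f s, f t) \<notin> {(a, b), (b, a)}"
              proof (cases "s = x \<or> t = x")
                case True
                then show ?thesis using st in_N[of s] in_N[of t] False ext.E_irrefl unfolding f_def by auto
              next
                case False
                then show ?thesis using st unfolding f_def by auto
              qed
              ultimately show ?thesis by auto
            qed
            have "f a = a" "f b = b" using ax bx unfolding f_def by auto
            then show ?thesis using descend[of f] f_step ax by blast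
          next
            case True
            then obtain y where y: "y \<in> N" "y \<in> H" "{a, b} = {v, y}" by auto
            show ?thesis
            proof (cases "N \<inter> H = {y}")
              case True
              \<comment> \<open>\<open>x\<close> hangs on \<open>y\<close> by its only edge in \<open>H\<close>, so folding \<open>x\<close> onto \<open>y\<close> just removes detours.\<close>
              define g where "g = (\<lambda>u. if u = x then y else u)"
              have g_step: "(g s, g t) \<in> (E \<inter> M \<times> M - {(a, b), (b, a)})\<^sup>*" if st: "(s, t) \<in> ?A" for s t
              proof (cases "s = x \<or> t = x")
                case True
                have only: "w = y" if "(x, w) \<in> E' \<or> (w, x) \<in> E'" "w \<in> H" for w
                  using in_N(1)[OF that(1)] that(2) \<open>N \<inter> H = {y}\<close> by blast
                have "s \<noteq> t" using st ext.E_irrefl by auto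
                then have "g s = g t" using True st only[of s] only[of t] unfolding g_def by auto
                then show ?thesis by simp
              next
                case False
                then have "(s, t) \<in> E \<inter> M \<times> M - {(a, b), (b, a)}" using st unfolding E'_def M_def by auto
                then show ?thesis using False unfolding g_def by auto
              qed
              have "g a = a" "g b = b" using ax bx unfolding g_def by auto
              then show ?thesis using descend[of g] g_step ax by blast
            next
              case False
              then obtain y' where y': "y' \<in> N" "y' \<in> H" "y' \<noteq> y" using y by auto
              have e: "(v, y') \<in> E'" "(y', v) \<in> E'" "(x, y) \<in> E'" "(y, x) \<in> E'" "(x, y') \<in> E'" "(y', x) \<in> E'"
                using N y y' E_commute unfolding E'_def by auto
              have "v \<noteq> x" using v x by auto
              consider "a = v" "b = y" | "a = y" "b = v" using y(3) by (auto simp: doubleton_eq_iff)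
              then show ?thesis
              proof cases
                case 1
                show ?thesis unfolding 1 using e xH y' \<open>v \<noteq> x\<close> by (intro bexI[of _ x] bexI[of _ y']) auto
              next
                case 2
                show ?thesis unfolding 2 using e xH y' \<open>v \<noteq> x\<close> by (intro bexI[of _ y'] bexI[of _ x]) auto
              qed
            qed
          qed
        qed
      qed
    qed
    show "\<exists>a'\<in>H. \<exists>b'\<in>H. a' \<noteq> a \<and> b' \<noteq> b \<and> (a, b') \<in> E' \<and> (a', b) \<in> E' \<and> (a', b') \<in> E'"
    proof (cases "b = x")
      case True
      then have "a \<noteq> x" using cyc ext.E_irrefl unfolding on_cycle_def by auto
      then show ?thesis using main[OF on_cycle_sym[OF E'_sym cyc]] ext.E_commute by blast
    qed (use main[OF cyc] in blast)
  qed
  then show ?thesis unfolding E'_def L'_def .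
qed

end

text \<open>
  The forest is built by induction on \<open>i\<close>, together with the invariant that the links of all vertices
  still to be added are convex in \<open>h i\<close>. If \<open>x (Suc i)\<close> enters such a link \<open>N\<close>, then either \<open>N\<close> was
  disjoint from \<open>h i\<close>, or the hypothesis puts the parent \<open>v i\<close> in \<open>N\<close> and \<open>N\<close> grows by a leaf.
\<close>

lemma FIDL_from_dismantling:
  fixes h :: "nat \<Rightarrow> 'a set"
  assumes "sym E" "E \<subseteq> h n \<times> h n" "\<And>u. (u, u) \<notin> E"
    and base: "distinct [a, b, c, d]" "h 0 = {a, b, c, d}"
      "E \<inter> h 0 \<times> h 0 = {a, b} \<times> {c, d} \<union> {c, d} \<times> {a, b}"
    and step: "\<And>i. i < n \<Longrightarrow> x (Suc i) \<notin> h i \<and> h (Suc i) = insert (x (Suc i)) (h i) \<and> v i \<in> h i \<and>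
        (\<forall>y\<in>h i. (x (Suc i), y) \<in> E \<longrightarrow> (v i, y) \<in> E)"
    and cond: "\<And>i j z. i < j \<Longrightarrow> j < n \<Longrightarrow> z \<in> h i \<Longrightarrow> (x (Suc j), x (Suc i)) \<in> E \<Longrightarrow>
        (x (Suc j), z) \<in> E \<Longrightarrow> (x (Suc j), v i) \<in> E"
  obtains L where "relational_FIDL (h n) E L"
proof -
  have "\<exists>L. link_convex_forest (h i) (E \<inter> h i \<times> h i) L \<and>
      (\<forall>j. i \<le> j \<and> j < n \<longrightarrow> convex_in L {u \<in> h i. (x (Suc j), u) \<in> E})" if "i \<le> n" for i
    using that
  proof (induction i)
    case 0
    then show ?case using square_forest[OF base(1)] base(2,3) by metis
  next
    case (Suc i)
    then obtain L where L: "link_convex_forest (h i) (E \<inter> h i \<times> h i) L"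
      and links: "\<And>j. i \<le> j \<Longrightarrow> j < n \<Longrightarrow> convex_in L {u \<in> h i. (x (Suc j), u) \<in> E}" by auto
    interpret link_convex_forest "h i" "E \<inter> h i \<times> h i" L by (rule L)
    have i: "i < n" using Suc by simp
    let ?x = "x (Suc i)"
    have x: "?x \<notin> h i" and hS: "h (Suc i) = insert ?x (h i)" and v: "v i \<in> h i"
      and dom: "\<And>y. y \<in> h i \<Longrightarrow> (?x, y) \<in> E \<Longrightarrow> (v i, y) \<in> E" using step[OF i] by auto
    define N where "N = {u \<in> h i. (?x, u) \<in> E}"
    let ?L' = "insert (?x, v i) (insert (v i, ?x) L)"
    have "link_convex_forest (insert ?x (h i)) (E \<inter> h i \<times> h i \<union> ({?x} \<times> N \<union> N \<times> {?x})) ?L'"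
      using attach_leaf[OF x v, of N] links[of i] i dom v unfolding N_def by auto
    moreover have "E \<inter> h i \<times> h i \<union> ({?x} \<times> N \<union> N \<times> {?x}) = E \<inter> h (Suc i) \<times> h (Suc i)"
      using assms(1,3) unfolding hS N_def by (auto dest: symD)
    ultimately have "link_convex_forest (h (Suc i)) (E \<inter> h (Suc i) \<times> h (Suc i)) ?L'"
      unfolding hS by simp
    moreover have "convex_in ?L' {u \<in> h (Suc i). (x (Suc j), u) \<in> E}" if j: "Suc i \<le> j" "j < n" for j
    proof -
      let ?P = "{u \<in> h i. (x (Suc j), u) \<in> E}"
      have P: "convex_in L ?P" "?P \<subseteq> h i" using links[of j] j by auto
      show ?thesis
      proof (cases "(x (Suc j), ?x) \<in> E")
        case False
        then have "{u \<in> h (Suc i). (x (Suc j), u) \<in> E} = ?P" unfolding hS by auto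
        then show ?thesis using attach_leaf_convex(1)[OF x v P] by simp
      next
        case True
        then have eq: "{u \<in> h (Suc i). (x (Suc j), u) \<in> E} = insert ?x ?P" unfolding hS by auto
        show ?thesis
        proof (cases "?P = {}")
          case True
          show ?thesis unfolding eq True by (simp add: convex_in_def)
        next
          case False
          then have "v i \<in> ?P" using cond[of i j] j v True by auto
          then show ?thesis unfolding eq using attach_leaf_convex(2)[OF x v P] by simp
        qed
      qed
    qed
    ultimately show ?case by auto
  qed
  then obtain L where "link_convex_forest (h n) (E \<inter> h n \<times> h n) L" by auto
  moreover have "E \<inter> h n \<times> h n = E" using assms(2) by auto
  ultimately interpret link_convex_forest "h n" E L by simp
  show thesis by (rule that) unfold_locales
qed

section \<open>Pair graphs and their arc relations\<close>

lemma pair_graph_iff: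
  "pair_graph G \<longleftrightarrow> finite (pverts G) \<and> parcs G \<subseteq> pverts G \<times> pverts G \<and> sym (parcs G) \<and>
     (\<forall>u. (u, u) \<notin> parcs G)"
proof
  assume "pair_graph G"
  then interpret pair_graph G .
  have "\<forall>u. (u, u) \<notin> parcs G" using no_loops' by blast
  then show "finite (pverts G) \<and> parcs G \<subseteq> pverts G \<times> pverts G \<and> sym (parcs G) \<and> (\<forall>u. (u, u) \<notin> parcs G)"
    using pair_finite_verts in_arcsD1 in_arcsD2 arcs_symmetric by (auto simp: sym_def)
next
  assume G: "finite (pverts G) \<and> parcs G \<subseteq> pverts G \<times> pverts G \<and> sym (parcs G) \<and> (\<forall>u. (u, u) \<notin> parcs G)"
  then have "finite (parcs G)" by (meson finite_SigmaI finite_subset)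
  then show "pair_graph G" using G
    by unfold_locales (auto simp: symmetric_def)
qed

lemma rtrancl_on_iff:
  "(a, b) \<in> rtrancl_on F r \<longleftrightarrow> a \<in> F \<and> b \<in> F \<and> (a, b) \<in> (r \<inter> F \<times> F)\<^sup>*"
proof
  assume "(a, b) \<in> rtrancl_on F r"
  then show "a \<in> F \<and> b \<in> F \<and> (a, b) \<in> (r \<inter> F \<times> F)\<^sup>*"
  proof (induction rule: rtrancl_on_induct)
    case (step y z)
    then have "(y, z) \<in> r \<inter> F \<times> F" by auto
    then show ?case using step by (meson rtrancl_into_rtrancl)
  qed auto
next
  assume "a \<in> F \<and> b \<in> F \<and> (a, b) \<in> (r \<inter> F \<times> F)\<^sup>*"
  then have "(a, b) \<in> (r \<inter> F \<times> F)\<^sup>*" "a \<in> F" by auto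
  then show "(a, b) \<in> rtrancl_on F r"
  proof induction
    case (step y z)
    then show ?case by (auto intro: rtrancl_on_into_rtrancl_on)
  qed auto
qed

text \<open>
  In a symmetric digraph reachability is an equivalence relation on the vertices, and the strongly
  connected components are its classes.
\<close>

lemma sccs_verts_gt_1_iff:
  fixes D :: "('a, 'b) pre_digraph"
  assumes "finite (verts D)" "sym (arcs_ends D)"
  shows "card (pre_digraph.sccs_verts D) > 1 \<longleftrightarrow> \<not> conn_on (arcs_ends D) (verts D)"
proof -
  let ?r = "\<lambda>u v. u \<rightarrow>\<^sup>*\<^bsub>D\<^esub> v"
  have r_in: "u \<in> verts D" "v \<in> verts D" if "?r u v" for u v
    using that by (auto simp: reachable_def rtrancl_on_iff)
  have r_sym: "?r v u" if "?r u v" for u v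
    using that assms(2) by (rule symmetric_reachable[unfolded symmetric_def, rotated])
  have r_trans: "?r u w" if "?r u v" "?r v w" for u v w
    using that unfolding reachable_def by (rule rtrancl_on_trans)
  have conn: "conn_on (arcs_ends D) (verts D) \<longleftrightarrow> (\<forall>u\<in>verts D. \<forall>v\<in>verts D. ?r u v)"
    by (auto simp: conn_on_def reachable_def rtrancl_on_iff)
  have S: "S \<in> pre_digraph.sccs_verts D \<longleftrightarrow> S \<noteq> {} \<and> (\<forall>u\<in>S. \<forall>v\<in>S. ?r u v) \<and>
      (\<forall>u\<in>S. \<forall>v. v \<notin> S \<longrightarrow> \<not> ?r u v \<or> \<not> ?r v u)" for S
    by (simp add: pre_digraph.sccs_verts_def)
  have S_sub: "T \<subseteq> verts D" if "T \<in> pre_digraph.sccs_verts D" for T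
  proof
    fix w assume "w \<in> T"
    then have "?r w w" using that unfolding S by simp
    then show "w \<in> verts D" by (rule r_in(1))
  qed
  show ?thesis
  proof
    assume gt: "card (pre_digraph.sccs_verts D) > 1"
    show "\<not> conn_on (arcs_ends D) (verts D)"
    proof
      assume "conn_on (arcs_ends D) (verts D)"
      then have all: "\<forall>u\<in>verts D. \<forall>v\<in>verts D. ?r u v" using conn by simp
      have "pre_digraph.sccs_verts D \<subseteq> {verts D}"
      proof
        fix T assume T: "T \<in> pre_digraph.sccs_verts D"
        then obtain u where u: "u \<in> T" using S by auto
        have TV: "T \<subseteq> verts D" using T by (rule S_sub)
        have "v \<in> T" if v: "v \<in> verts D" for v
        proof (rule ccontr)
          assume "v \<notin> T"
          then have "\<not> ?r u v \<or> \<not> ?r v u" using T u unfolding S by blast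
          then show False using all u v TV by auto
        qed
        then show "T \<in> {verts D}" using TV by auto
      qed
      then have "card (pre_digraph.sccs_verts D) \<le> 1"
        using card_mono[of "{verts D}"] by fastforce
      then show False using gt by simp
    qed
  next
    assume "\<not> conn_on (arcs_ends D) (verts D)"
    then obtain u v where uv: "u \<in> verts D" "v \<in> verts D" "\<not> ?r u v" using conn by auto
    have refl: "?r w w" if "w \<in> verts D" for w using that by (auto simp: reachable_def)
    have scc: "{w. ?r s w} \<in> pre_digraph.sccs_verts D" if "s \<in> verts D" for s
      unfolding S using refl[OF that] r_sym r_trans by blast
    have "{w. ?r u w} \<noteq> {w. ?r v w}" using uv refl by auto
    then have "card {{w. ?r u w}, {w. ?r v w}} = 2" by simp
    moreover have "finite (pre_digraph.sccs_verts D)"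
      by (rule finite_subset[of _ "Pow (verts D)"]) (use S_sub assms(1) in auto)
    then have "card {{w. ?r u w}, {w. ?r v w}} \<le> card (pre_digraph.sccs_verts D)"
      using scc uv by (intro card_mono) auto
    ultimately show "card (pre_digraph.sccs_verts D) > 1" by simp
  qed
qed

lemma has_separating_clique_iff:
  assumes "finite (pverts G)" "sym (parcs G)"
  shows "has_separating_clique G \<longleftrightarrow> \<not> no_separating_clique (parcs G) (pverts G)"
proof -
  have "card (pre_digraph.sccs_verts (with_proj G \<restriction> S)) > 1 \<longleftrightarrow> \<not> conn_on (parcs G) S"
    if "S \<subseteq> pverts G" for S
  proof -
    have e: "arcs_ends (with_proj G \<restriction> S) = parcs G \<inter> S \<times> S"
      by (auto simp: arcs_ends_conv induce_subgraph_def)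
    have "conn_on (parcs G \<inter> S \<times> S) S \<longleftrightarrow> conn_on (parcs G) S"
      unfolding conn_on_def by (simp add: Int_assoc)
    then show ?thesis
      using sccs_verts_gt_1_iff[of "with_proj G \<restriction> S"] e that assms sym_restrict[OF assms(2)]
      by (auto dest: finite_subset)
  qed
  then show ?thesis
    unfolding has_separating_clique_def no_separating_clique_def clique_def by (metis Diff_subset)
qed

lemma connected_iff:
  assumes "pair_graph T"
  shows "connected (with_proj T) \<longleftrightarrow> pverts T \<noteq> {} \<and> conn_on (parcs T) (pverts T)"
proof -
  have "parcs (mk_symmetric (with_proj T)) = parcs T"
    using assms unfolding pair_graph_iff mk_symmetric_def by (auto dest: symD)
  moreover have "pverts (mk_symmetric (with_proj T)) = pverts T"
    by (simp add: mk_symmetric_def)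
  ultimately show ?thesis
    by (auto simp: connected_def strongly_connected_def reachable_def rtrancl_on_iff conn_on_def)
qed

section \<open>Cycles and bridges\<close>

lemma pcas_rtrancl: "pcas u p v \<Longrightarrow> set p \<subseteq> A \<Longrightarrow> (u, v) \<in> A\<^sup>*"
proof (induction p arbitrary: u)
  case (Cons e es)
  then have "(u, snd e) \<in> A" by (cases e) auto
  moreover have "(snd e, v) \<in> A\<^sup>*" using Cons by auto
  ultimately show ?case by (rule converse_rtrancl_into_rtrancl)
qed auto

lemma pcas_append: "pcas u (p @ q) v \<longleftrightarrow> (\<exists>w. pcas u p w \<and> pcas w q v)"
  by (induction p arbitrary: u) auto

lemma pcas_source: "pcas u p v \<Longrightarrow> e \<in> set p \<Longrightarrow> fst e = u \<or> fst e \<in> snd ` set p"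
  by (induction p arbitrary: u) auto

lemma pcas_target: "pcas u p v \<Longrightarrow> e \<in> set p \<Longrightarrow> snd e = v \<or> snd e \<in> fst ` set p"
proof (induction p arbitrary: u)
  case (Cons d es)
  show ?case
  proof (cases "e \<in> set es")
    case True then show ?thesis using Cons by auto
  next
    case False
    then show ?thesis using Cons.prems by (cases es) auto
  qed
qed auto

lemma pawalk_verts_pcas: "pcas u p v \<Longrightarrow> pawalk_verts u p = u # map snd p"
  by (induction p arbitrary: u) auto

lemma awalk_iff: "pre_digraph.awalk (with_proj G) u p v \<longleftrightarrow> u \<in> pverts G \<and> set p \<subseteq> parcs G \<and> pcas u p v"
  by (simp add: pre_digraph.awalk_def cas_with_proj_eq)

lemma graph_cycle_iff:
  "graph_cycle G p \<longleftrightarrow>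
     (\<exists>u\<in>pverts G. set p \<subseteq> parcs G \<and> pcas u p u \<and> distinct (map snd p) \<and> 3 \<le> length p)"
proof -
  have "pre_digraph.cycle (with_proj G) p \<longleftrightarrow>
     (\<exists>u\<in>pverts G. set p \<subseteq> parcs G \<and> pcas u p u \<and> distinct (map snd p) \<and> p \<noteq> [])"
    unfolding pre_digraph.cycle_def awalk_iff awalk_verts_with_proj_eq
    using pawalk_verts_pcas by fastforce
  then show ?thesis unfolding graph_cycle_def by auto
qed

lemma apath_iff:
  "pre_digraph.apath (with_proj G) u p v \<longleftrightarrow>
     u \<in> pverts G \<and> set p \<subseteq> parcs G \<and> pcas u p v \<and> distinct (u # map snd p)"
  unfolding pre_digraph.apath_def awalk_iff awalk_verts_with_proj_eq
  using pawalk_verts_pcas by metis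

text \<open>
  Rotate the cycle so that it begins with \<open>(a,b)\<close>; the rest \<open>q\<close> is a walk from \<open>b\<close> to \<open>a\<close>. The arcs of a
  cycle have distinct targets, hence \<open>q\<close> does not return to \<open>b\<close>. So \<open>q\<close> could use the edge \<open>ab\<close> only in
  its first step, and this would force the length 2.
\<close>

lemma cycle_edge_on_cycle:
  assumes "graph_cycle G \<gamma>" "(a, b) \<in> set \<gamma>" "fst ` set \<gamma> \<subseteq> H" "\<And>u. (u, u) \<notin> parcs G" "sym (parcs G)"
  shows "on_cycle (parcs G) H a b"
proof -
  obtain u where g: "set \<gamma> \<subseteq> parcs G" "pcas u \<gamma> u" "distinct (map snd \<gamma>)" "3 \<le> length \<gamma>"
    using assms(1) unfolding graph_cycle_iff by auto
  obtain p1 p2 where split: "\<gamma> = p1 @ (a, b) # p2" using assms(2) by (meson split_list)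
  define q where "q = p2 @ p1"
  have "pcas u p1 a" "pcas b p2 u" using g(2) unfolding split pcas_append by auto
  then have "pcas b q a" unfolding q_def pcas_append by auto
  then have q: "pcas b q a" "distinct (b # map snd q)" "2 \<le> length q" "set \<gamma> = insert (a, b) (set q)"
    using g split unfolding q_def by auto
  have arcs_in: "set \<gamma> \<subseteq> parcs G \<inter> H \<times> H"
  proof
    fix e assume e: "e \<in> set \<gamma>"
    have "u \<in> fst ` set \<gamma>" using g by (cases \<gamma>) auto
    then have "snd e \<in> fst ` set \<gamma>" using pcas_target[OF g(2) e] by auto
    then show "e \<in> parcs G \<inter> H \<times> H" using assms(3) g(1) e by (cases e) force
  qed
  have "(a, b) \<notin> set q" using q(2) by force
  moreover have "(b, a) \<notin> set q"
  proof
    assume ba: "(b, a) \<in> set q"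
    obtain c q' where q': "q = (b, c) # q'" "pcas c q' a" "q' \<noteq> []" using q(1,3) by (cases q; cases "tl q") auto
    have "a \<in> snd ` set q'"
    proof -
      have "last q' \<in> set q'" using q' by simp
      moreover have "snd (last q') = a" using q'(2,3) by (induction q' arbitrary: c) auto
      ultimately show ?thesis by force
    qed
    then have "c \<noteq> a" using q(2) q'(1) by auto
    then have "(b, a) \<in> set q'" using ba q'(1) by auto
    then have "b = c \<or> b \<in> snd ` set q'" using pcas_source[OF q'(2)] by force
    then show False using q(2) q'(1) by auto
  qed
  ultimately have "set q \<subseteq> parcs G \<inter> H \<times> H - {(b, a), (a, b)}" using arcs_in q(4) by auto
  then have "(b, a) \<in> (parcs G \<inter> H \<times> H - {(b, a), (a, b)})\<^sup>*" by (rule pcas_rtrancl[OF q(1)])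
  moreover have "(b, a) \<in> parcs G \<inter> H \<times> H" using arcs_in assms(2,5) by (auto dest: symD)
  ultimately have "on_cycle (parcs G) H b a" unfolding on_cycle_def by simp
  then show ?thesis by (rule on_cycle_sym[OF assms(5)])
qed

lemma simple_walk_exists:
  assumes "(p, q) \<in> A\<^sup>*"
  shows "\<exists>ws. pcas p ws q \<and> set ws \<subseteq> A \<and> distinct (p # map snd ws)"
proof -
  define D where "D = \<lparr>pverts = UNIV, parcs = A\<rparr>"
  interpret pair_wf_digraph D by unfold_locales (auto simp: D_def)
  have "p \<rightarrow>\<^sup>*\<^bsub>with_proj D\<^esub> q" using assms by (simp add: reachable_def rtrancl_on_iff D_def)
  then obtain ws where "apath p ws q" unfolding reachable_apath by auto
  then show ?thesis unfolding apath_iff D_def by auto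
qed

lemma on_cycle_graph_cycle:
  assumes "on_cycle (parcs G) H a b" "H \<subseteq> pverts G" "sym (parcs G)" "\<And>u. (u, u) \<notin> parcs G"
  shows "\<exists>\<gamma>. graph_cycle G \<gamma> \<and> (a, b) \<in> set \<gamma> \<and> fst ` set \<gamma> \<subseteq> H"
proof -
  let ?A = "parcs G \<inter> H \<times> H - {(b, a), (a, b)}"
  have ab: "(a, b) \<in> parcs G \<inter> H \<times> H" using assms(1) unfolding on_cycle_def by auto
  have ba: "(b, a) \<in> ?A\<^sup>*" using on_cycle_sym[OF assms(3,1)] unfolding on_cycle_def by auto
  obtain ws where ws: "pcas b ws a" "set ws \<subseteq> ?A" "distinct (b # map snd ws)"
    using simple_walk_exists[OF ba] by metis
  have "2 \<le> length ws"
  proof -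
    have "ws \<noteq> []" using ws(1) ab assms(4) by auto
    moreover have "length ws \<noteq> 1"
    proof
      assume "length ws = 1"
      then obtain e where "ws = [e]" by (auto simp: length_Suc_conv)
      then have "(b, a) \<in> ?A" using ws(1,2) by (cases e) auto
      then show False by simp
    qed
    ultimately show ?thesis by (cases ws; cases "tl ws") auto
  qed
  then have "graph_cycle G ((a, b) # ws)"
    unfolding graph_cycle_iff using ws ab assms(2) by (intro bexI[of _ a]) auto
  moreover have "fst ` set ((a, b) # ws) \<subseteq> H" using ws(2) ab by auto
  ultimately show ?thesis by (intro exI[of _ "(a, b) # ws"]) simp
qed

section \<open>Trees\<close>

text \<open>
  A graph has no cycle if and only if each of its edges is a bridge.
\<close>

lemma is_tree_iff:
  "is_tree T \<longleftrightarrow> pair_graph T \<and> pverts T \<noteq> {} \<and> conn_on (parcs T) (pverts T) \<and>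
     (\<forall>u v. (u, v) \<in> parcs T \<longrightarrow> (u, v) \<notin> (parcs T - {(u, v), (v, u)})\<^sup>*)"
proof (cases "pair_graph T")
  case True
  then have T: "parcs T \<inter> pverts T \<times> pverts T = parcs T" "sym (parcs T)" "\<And>u. (u, u) \<notin> parcs T"
    unfolding pair_graph_iff by auto
  have "(\<exists>\<gamma>. graph_cycle T \<gamma>) \<longleftrightarrow> (\<exists>u v. on_cycle (parcs T) (pverts T) u v)"
  proof
    assume "\<exists>\<gamma>. graph_cycle T \<gamma>"
    then obtain \<gamma> where c: "graph_cycle T \<gamma>" by auto
    then have "set \<gamma> \<subseteq> parcs T" "\<gamma> \<noteq> []" unfolding graph_cycle_iff by auto
    then have "fst ` set \<gamma> \<subseteq> pverts T" "hd \<gamma> \<in> set \<gamma>" using True unfolding pair_graph_iff by auto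
    then show "\<exists>u v. on_cycle (parcs T) (pverts T) u v"
      using cycle_edge_on_cycle[OF c, of "fst (hd \<gamma>)" "snd (hd \<gamma>)"] T by auto
  next
    assume "\<exists>u v. on_cycle (parcs T) (pverts T) u v"
    then show "\<exists>\<gamma>. graph_cycle T \<gamma>" using on_cycle_graph_cycle[of T "pverts T"] T by blast
  qed
  also have "\<dots> \<longleftrightarrow> (\<exists>u v. (u, v) \<in> parcs T \<and> (u, v) \<in> (parcs T - {(u, v), (v, u)})\<^sup>*)"
    unfolding on_cycle_def T(1) ..
  finally show ?thesis unfolding is_tree_def using True connected_iff by blast
qed (simp add: is_tree_def)

text \<open>
  If \<open>C\<close> is connected and a simple path between two of its vertices left \<open>C\<close> along the edge \<open>uw\<close>, then
  the rest of the path, which avoids \<open>u\<close>, followed by a walk inside \<open>C\<close>, which avoids \<open>w\<close>, would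
  connect \<open>w\<close> to \<open>u\<close> without the bridge \<open>uw\<close>.
\<close>

lemma tree_convex_iff:
  assumes "is_tree T"
  shows "tree_convex T C \<longleftrightarrow> C \<subseteq> pverts T \<and> conn_on (parcs T) C"
proof -
  have T: "conn_on (parcs T) (pverts T)" "sym (parcs T)"
    "\<And>u v. (u, v) \<in> parcs T \<Longrightarrow> (u, v) \<notin> (parcs T - {(u, v), (v, u)})\<^sup>*"
    "parcs T \<subseteq> pverts T \<times> pverts T"
    using assms unfolding is_tree_iff pair_graph_iff by auto
  have verts: "set (pawalk_verts u p) = insert u (snd ` set p)" if "pcas u p v" for u p v
    using pawalk_verts_pcas[OF that] by simp
  show ?thesis
  proof (intro iffI conjI)
    assume C: "tree_convex T C"
    then show "C \<subseteq> pverts T" unfolding tree_convex_def by simp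
    show "conn_on (parcs T) C"
      unfolding conn_on_def
    proof (intro ballI)
      fix u v assume uv: "u \<in> C" "v \<in> C"
      then have uv_path: "(u, v) \<in> (parcs T)\<^sup>*"
        using T(1) \<open>C \<subseteq> pverts T\<close> rtrancl_mono[of "parcs T \<inter> pverts T \<times> pverts T" "parcs T"]
        unfolding conn_on_def by blast
      obtain p where p: "pcas u p v" "set p \<subseteq> parcs T" "distinct (u # map snd p)"
        using simple_walk_exists[OF uv_path] by metis
      then have "pre_digraph.apath (with_proj T) u p v"
        unfolding apath_iff using uv \<open>C \<subseteq> pverts T\<close> by auto
      then have in_C: "insert u (snd ` set p) \<subseteq> C" using C uv verts[OF p(1)] unfolding tree_convex_def by blast
      have "set p \<subseteq> parcs T \<inter> C \<times> C"
      proof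
        fix e assume e: "e \<in> set p"
        have "fst e \<in> C" using pcas_source[OF p(1) e] in_C by auto
        moreover have "snd e \<in> C" using e in_C by auto
        ultimately show "e \<in> parcs T \<inter> C \<times> C" using e p(2) by (cases e) auto
      qed
      then show "(u, v) \<in> (parcs T \<inter> C \<times> C)\<^sup>*" by (rule pcas_rtrancl[OF p(1)])
    qed
  next
    assume C: "C \<subseteq> pverts T \<and> conn_on (parcs T) C"
    have stays: "insert u (snd ` set p) \<subseteq> C"
      if "pcas u p v" "set p \<subseteq> parcs T" "distinct (u # map snd p)" "u \<in> C" "v \<in> C" for u p v
      using that
    proof (induction p arbitrary: u)
      case (Cons e es)
      obtain w where e: "e = (u, w)" "(u, w) \<in> parcs T" using Cons.prems by (cases e) auto
      show ?case
      proof (cases "w \<in> C")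
        case True
        then show ?thesis using Cons e by auto
      next
        case False
        have es: "pcas w es v" "set es \<subseteq> parcs T" using Cons.prems e by auto
        have "set es \<subseteq> parcs T - {(u, w), (w, u)}"
        proof
          fix d assume d: "d \<in> set es"
          have "fst d \<noteq> u" using pcas_source[OF es(1) d] Cons.prems(3) e by auto
          moreover have "snd d \<noteq> u" using d Cons.prems(3) by auto
          ultimately show "d \<in> parcs T - {(u, w), (w, u)}" using d es by auto
        qed
        then have "(w, v) \<in> (parcs T - {(u, w), (w, u)})\<^sup>*" by (rule pcas_rtrancl[OF es(1)])
        moreover have "(u, v) \<in> (parcs T \<inter> C \<times> C)\<^sup>*" using C Cons.prems unfolding conn_on_def by auto
        then have "(u, v) \<in> (parcs T - {(u, w), (w, u)})\<^sup>*"
          by (rule rtrancl_mono[THEN subsetD, rotated]) (use False in auto)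
        ultimately have "(u, w) \<in> (parcs T - {(u, w), (w, u)})\<^sup>*"
          using rtrancl_sym[OF sym_minus_edge[OF T(2)]] by (meson rtrancl_trans)
        then show ?thesis using T(3) e by auto
      qed
    qed auto
    show "tree_convex T C"
      unfolding tree_convex_def apath_iff
    proof (intro conjI ballI allI impI)
      fix u v p
      assume "u \<in> C" "v \<in> C"
        and p: "u \<in> pverts T \<and> set p \<subseteq> parcs T \<and> pcas u p v \<and> distinct (u # map snd p)"
      then have "insert u (snd ` set p) \<subseteq> C" using stays[of u p v] by simp
      then show "set (pawalk_verts u p) \<subseteq> C" using verts[of u p v] p by simp
    qed (use C in simp)
  qed
qed

lemma tree_hull_convex:
  assumes "S \<subseteq> pverts T" "is_tree T"
  shows "tree_convex T (tree_hull T S)" "S \<subseteq> tree_hull T S"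
proof -
  have T: "tree_convex T (pverts T)" using assms(2) tree_convex_iff is_tree_iff by auto
  show "tree_convex T (tree_hull T S)"
    unfolding tree_convex_def
  proof (intro conjI ballI allI impI)
    show "tree_hull T S \<subseteq> pverts T" using T assms(1) unfolding tree_hull_def by auto
    fix u v p assume uv: "u \<in> tree_hull T S" "v \<in> tree_hull T S" "pre_digraph.apath (with_proj T) u p v"
    show "set (pawalk_verts u p) \<subseteq> tree_hull T S"
      unfolding tree_hull_def
    proof (intro Inter_greatest)
      fix C assume C: "C \<in> {C. tree_convex T C \<and> S \<subseteq> C}"
      then have "u \<in> C" "v \<in> C" using uv unfolding tree_hull_def by auto
      then show "set (pawalk_verts u p) \<subseteq> C" using C uv(3) unfolding tree_convex_def by auto
    qed
  qed
  show "S \<subseteq> tree_hull T S" unfolding tree_hull_def by auto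
qed

section \<open>Two trees as one forest\<close>

lemma rtrancl_in_part:
  assumes "(u, w) \<in> ((A \<union> A') - X)\<^sup>*" "u \<in> R" "A \<subseteq> R \<times> R" "A' \<subseteq> B \<times> B" "R \<inter> B = {}"
  shows "w \<in> R \<and> (u, w) \<in> (A - X)\<^sup>*"
  using assms(1)
proof induction
  case (step s t)
  then have "(s, t) \<in> A - X" "t \<in> R" using assms(3-5) by auto
  then show ?case using step by (meson rtrancl_into_rtrancl)
qed (use assms(2) in auto)

text \<open>
  The facts about a single tree are proved for \<open>\<Lambda>r\<close> and transferred to \<open>\<Lambda>b\<close> by the symmetry \<open>swap\<close>.
\<close>

locale tree_pair =
  fixes \<Lambda>r \<Lambda>b :: "'a pair_pre_digraph"
  assumes trees: "is_tree \<Lambda>r" "is_tree \<Lambda>b" and disjoint: "pverts \<Lambda>r \<inter> pverts \<Lambda>b = {}"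
begin

definition L where "L = parcs \<Lambda>r \<union> parcs \<Lambda>b"

lemma swap: "tree_pair \<Lambda>b \<Lambda>r" "tree_pair.L \<Lambda>b \<Lambda>r = L"
proof -
  show sw: "tree_pair \<Lambda>b \<Lambda>r" using trees disjoint by unfold_locales auto
  show "tree_pair.L \<Lambda>b \<Lambda>r = L" unfolding tree_pair.L_def[OF sw] L_def by auto
qed

lemma parcs_sub: "parcs \<Lambda>r \<subseteq> pverts \<Lambda>r \<times> pverts \<Lambda>r" "parcs \<Lambda>b \<subseteq> pverts \<Lambda>b \<times> pverts \<Lambda>b"
  using trees unfolding is_tree_iff pair_graph_iff by auto

lemma path_in_red:
  assumes "(u, w) \<in> (L - X)\<^sup>*" "u \<in> pverts \<Lambda>r"
  shows "w \<in> pverts \<Lambda>r" "(u, w) \<in> (parcs \<Lambda>r - X)\<^sup>*"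
  using rtrancl_in_part[OF assms[unfolded L_def] parcs_sub disjoint] by auto

lemma red_connected: "u \<in> pverts \<Lambda>r \<Longrightarrow> w \<in> pverts \<Lambda>r \<Longrightarrow> (u, w) \<in> L\<^sup>*"
proof -
  assume "u \<in> pverts \<Lambda>r" "w \<in> pverts \<Lambda>r"
  then have "(u, w) \<in> (parcs \<Lambda>r \<inter> pverts \<Lambda>r \<times> pverts \<Lambda>r)\<^sup>*"
    using trees(1) unfolding is_tree_iff conn_on_def by auto
  then show ?thesis by (rule rtrancl_mono[THEN subsetD, rotated]) (auto simp: L_def)
qed

lemma red_bridge: "(u, w) \<in> parcs \<Lambda>r \<Longrightarrow> (u, w) \<notin> (L - {(u, w), (w, u)})\<^sup>*"
  using path_in_red(2)[of u w "{(u, w), (w, u)}"] trees(1) parcs_sub unfolding is_tree_iff by blast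

lemma red_part_convex:
  assumes "convex_in L H" shows "tree_convex \<Lambda>r (H \<inter> pverts \<Lambda>r)"
proof -
  have "conn_on (parcs \<Lambda>r) (H \<inter> pverts \<Lambda>r)"
    unfolding conn_on_def
  proof (intro ballI)
    fix u w assume uw: "u \<in> H \<inter> pverts \<Lambda>r" "w \<in> H \<inter> pverts \<Lambda>r"
    then have "(u, w) \<in> (L \<inter> H \<times> H)\<^sup>*" using assms red_connected unfolding convex_in_def by auto
    then have "(u, w) \<in> (L - - (H \<times> H))\<^sup>*" by (simp add: Diff_eq)
    then have "(u, w) \<in> (parcs \<Lambda>r - - (H \<times> H))\<^sup>*" by (rule path_in_red(2)) (use uw in simp)
    then show "(u, w) \<in> (parcs \<Lambda>r \<inter> (H \<inter> pverts \<Lambda>r) \<times> (H \<inter> pverts \<Lambda>r))\<^sup>*"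
      by (rule rtrancl_mono[THEN subsetD, rotated]) (use parcs_sub in auto)
  qed
  then show ?thesis using tree_convex_iff[OF trees(1)] by auto
qed

lemma red_path_in_convex:
  assumes "tree_convex \<Lambda>r (H \<inter> pverts \<Lambda>r)" "u \<in> H \<inter> pverts \<Lambda>r" "w \<in> H \<inter> pverts \<Lambda>r"
  shows "(u, w) \<in> (L \<inter> H \<times> H)\<^sup>*"
proof -
  have "(u, w) \<in> (parcs \<Lambda>r \<inter> (H \<inter> pverts \<Lambda>r) \<times> (H \<inter> pverts \<Lambda>r))\<^sup>*"
    using assms tree_convex_iff[OF trees(1)] unfolding conn_on_def by blast
  then show ?thesis by (rule rtrancl_mono[THEN subsetD, rotated]) (auto simp: L_def)
qed

lemma convex_in_iff:
  assumes "H \<subseteq> pverts \<Lambda>r \<union> pverts \<Lambda>b"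
  shows "convex_in L H \<longleftrightarrow> tree_convex \<Lambda>r (H \<inter> pverts \<Lambda>r) \<and> tree_convex \<Lambda>b (H \<inter> pverts \<Lambda>b)"
proof
  assume "convex_in L H"
  then show "tree_convex \<Lambda>r (H \<inter> pverts \<Lambda>r) \<and> tree_convex \<Lambda>b (H \<inter> pverts \<Lambda>b)"
    using red_part_convex tree_pair.red_part_convex[OF swap(1)] swap(2) by auto
next
  assume c: "tree_convex \<Lambda>r (H \<inter> pverts \<Lambda>r) \<and> tree_convex \<Lambda>b (H \<inter> pverts \<Lambda>b)"
  show "convex_in L H"
    unfolding convex_in_def
  proof (intro ballI impI)
    fix u w assume uw: "u \<in> H" "w \<in> H" "(u, w) \<in> L\<^sup>*"
    consider "u \<in> pverts \<Lambda>r" | "u \<in> pverts \<Lambda>b" using uw assms by auto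
    then show "(u, w) \<in> (L \<inter> H \<times> H)\<^sup>*"
    proof cases
      case 1
      then show ?thesis using red_path_in_convex c uw path_in_red(1)[of u w "{}"] by auto
    next
      case 2
      then show ?thesis
        using tree_pair.red_path_in_convex[OF swap(1)] tree_pair.path_in_red(1)[OF swap(1), of u w "{}"]
          swap(2) c uw by auto
    qed
  qed
qed

lemma forest_hull_convex:
  assumes "S \<subseteq> pverts \<Lambda>r \<union> pverts \<Lambda>b"
  shows "convex_in L (forest_hull \<Lambda>r \<Lambda>b S)" "S \<subseteq> forest_hull \<Lambda>r \<Lambda>b S"
    "forest_hull \<Lambda>r \<Lambda>b S \<subseteq> pverts \<Lambda>r \<union> pverts \<Lambda>b"
proof -
  let ?h = "forest_hull \<Lambda>r \<Lambda>b S"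
  have r: "tree_convex \<Lambda>r (tree_hull \<Lambda>r (S \<inter> pverts \<Lambda>r))" "S \<inter> pverts \<Lambda>r \<subseteq> tree_hull \<Lambda>r (S \<inter> pverts \<Lambda>r)"
    and b: "tree_convex \<Lambda>b (tree_hull \<Lambda>b (S \<inter> pverts \<Lambda>b))" "S \<inter> pverts \<Lambda>b \<subseteq> tree_hull \<Lambda>b (S \<inter> pverts \<Lambda>b)"
    using tree_hull_convex trees by (metis inf_le2)+
  have sub: "tree_hull \<Lambda>r (S \<inter> pverts \<Lambda>r) \<subseteq> pverts \<Lambda>r" "tree_hull \<Lambda>b (S \<inter> pverts \<Lambda>b) \<subseteq> pverts \<Lambda>b"
    using r b unfolding tree_convex_def by auto
  then have "?h \<inter> pverts \<Lambda>r = tree_hull \<Lambda>r (S \<inter> pverts \<Lambda>r)" "?h \<inter> pverts \<Lambda>b = tree_hull \<Lambda>b (S \<inter> pverts \<Lambda>b)"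
    using disjoint unfolding forest_hull_def by auto
  moreover show hV: "?h \<subseteq> pverts \<Lambda>r \<union> pverts \<Lambda>b" using sub unfolding forest_hull_def by auto
  ultimately show "convex_in L ?h" using convex_in_iff r b by auto
  show "S \<subseteq> ?h" using r b assms unfolding forest_hull_def by auto
qed

lemma forest_hull_eq:
  assumes "S \<subseteq> pverts \<Lambda>r \<union> pverts \<Lambda>b"
  shows "forest_hull \<Lambda>r \<Lambda>b S = hull_in (pverts \<Lambda>r \<union> pverts \<Lambda>b) L S"
proof
  let ?h = "forest_hull \<Lambda>r \<Lambda>b S"
  show "hull_in (pverts \<Lambda>r \<union> pverts \<Lambda>b) L S \<subseteq> ?h"
    using forest_hull_convex[OF assms] unfolding hull_in_def by auto
  show "?h \<subseteq> hull_in (pverts \<Lambda>r \<union> pverts \<Lambda>b) L S"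
    unfolding hull_in_def
  proof (intro Inter_greatest)
    fix H assume "H \<in> {H. H \<subseteq> pverts \<Lambda>r \<union> pverts \<Lambda>b \<and> convex_in L H \<and> S \<subseteq> H}"
    then have "tree_convex \<Lambda>r (H \<inter> pverts \<Lambda>r)" "tree_convex \<Lambda>b (H \<inter> pverts \<Lambda>b)" "S \<subseteq> H"
      using convex_in_iff by auto
    then have "tree_hull \<Lambda>r (S \<inter> pverts \<Lambda>r) \<subseteq> H \<inter> pverts \<Lambda>r" "tree_hull \<Lambda>b (S \<inter> pverts \<Lambda>b) \<subseteq> H \<inter> pverts \<Lambda>b"
      unfolding tree_hull_def by auto
    then show "?h \<subseteq> H" unfolding forest_hull_def by auto
  qed
qed

lemma two_coloured_forest:
  assumes "E \<subseteq> pverts \<Lambda>r \<times> pverts \<Lambda>b \<union> pverts \<Lambda>b \<times> pverts \<Lambda>r" "sym E"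
  shows "two_coloured_forest (pverts \<Lambda>r \<union> pverts \<Lambda>b) E L"
proof
  have t: "pair_graph \<Lambda>r" "pair_graph \<Lambda>b" using trees unfolding is_tree_iff by auto
  show "finite (pverts \<Lambda>r \<union> pverts \<Lambda>b)" using t unfolding pair_graph_iff by auto
  show "E \<subseteq> (pverts \<Lambda>r \<union> pverts \<Lambda>b) \<times> (pverts \<Lambda>r \<union> pverts \<Lambda>b)" using assms(1) by auto
  show "sym E" by fact
  show "L \<subseteq> (pverts \<Lambda>r \<union> pverts \<Lambda>b) \<times> (pverts \<Lambda>r \<union> pverts \<Lambda>b)" using parcs_sub unfolding L_def by auto
  show "sym L" using t unfolding pair_graph_iff L_def by (auto intro: sym_Un)
  show "(u, v) \<notin> (L - {(u, v), (v, u)})\<^sup>*" if "(u, v) \<in> L" for u v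
    using that red_bridge tree_pair.red_bridge[OF swap(1)] swap(2) unfolding L_def by auto
  show "(u, v) \<notin> L\<^sup>*" if "(u, v) \<in> E" for u v
    using that assms(1) path_in_red(1)[of u v "{}"] tree_pair.path_in_red(1)[OF swap(1), of u v "{}"]
      swap(2) disjoint by auto
  show "(u, w) \<in> L\<^sup>* \<or> (v, w) \<in> L\<^sup>*" if "(u, v) \<in> E" "w \<in> pverts \<Lambda>r \<union> pverts \<Lambda>b" for u v w
    using that assms(1) red_connected tree_pair.red_connected[OF swap(1)] swap(2) by auto
qed

end

lemma join_subgraph_iff:
  assumes "pair_graph G"
  shows "subgraph (with_proj (join A B)) (with_proj G) \<longleftrightarrow> A \<union> B \<subseteq> pverts G \<and> A \<times> B \<subseteq> parcs G"
proof -
  have G: "parcs G \<subseteq> pverts G \<times> pverts G" "sym (parcs G)" using assms unfolding pair_graph_iff by auto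
  have "wf_digraph (with_proj G)" "wf_digraph (with_proj (join A B))"
    using G unfolding wf_digraph_wp_iff pair_wf_digraph_def join_def by auto
  then have "subgraph (with_proj (join A B)) (with_proj G) \<longleftrightarrow> A \<union> B \<subseteq> pverts G \<and> A \<times> B \<union> B \<times> A \<subseteq> parcs G"
    by (simp add: subgraph_def compatible_def join_def)
  then show ?thesis using G(2) by (auto dest: symD)
qed

lemma square_in_iff:
  assumes "pair_graph G"
  shows "square_in G a b c d \<longleftrightarrow> a \<noteq> b \<and> c \<noteq> d \<and>
    (a, c) \<in> parcs G \<and> (a, d) \<in> parcs G \<and> (b, c) \<in> parcs G \<and> (b, d) \<in> parcs G"
  using assms unfolding square_in_def join_subgraph_iff[OF assms] pair_graph_iff by auto

lemma induced_part:
  assumes "S \<subseteq> R \<times> R" "S' \<subseteq> B \<times> B" "A \<subseteq> R \<times> B \<union> B \<times> R" "R \<inter> B = {}"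
  shows "S = {e \<in> A \<union> (S \<union> S'). fst e \<in> R \<and> snd e \<in> R}"
proof (intro equalityI subrelI)
  fix u w assume "(u, w) \<in> S"
  then show "(u, w) \<in> {e \<in> A \<union> (S \<union> S'). fst e \<in> R \<and> snd e \<in> R}" using assms(1) by auto
next
  fix u w assume "(u, w) \<in> {e \<in> A \<union> (S \<union> S'). fst e \<in> R \<and> snd e \<in> R}"
  then have "(u, w) \<in> A \<union> S \<union> S'" "u \<in> R" "w \<in> R" by auto
  moreover from this have "u \<notin> B" "w \<notin> B" using assms(4) by auto
  ultimately show "(u, w) \<in> S" using assms(2,3) by auto
qed

text \<open>
  A tree that is induced in \<open>\<Theta>\<close> but consists of non-edges of \<open>\<Gamma>\<close> cannot contain both ends of an edge
  of \<open>\<Gamma>\<close>; conversely, for bipartite \<open>\<Gamma>\<close> any two trees on the colour classes have these properties.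
\<close>

lemma FIDL_structure_iff:
  assumes "pair_graph \<Gamma>" "is_tree \<Lambda>r" "is_tree \<Lambda>b" "pverts \<Lambda>r \<inter> pverts \<Lambda>b = {}"
  shows "subgraph (with_proj \<Lambda>r) (with_proj (graph_complement \<Gamma>)) \<and>
     subgraph (with_proj \<Lambda>b) (with_proj (graph_complement \<Gamma>)) \<and>
     induced_subgraph (with_proj \<Lambda>r) (with_proj (theta_graph \<Gamma> \<Lambda>r \<Lambda>b)) \<and>
     induced_subgraph (with_proj \<Lambda>b) (with_proj (theta_graph \<Gamma> \<Lambda>r \<Lambda>b)) \<and>
     pverts \<Gamma> \<subseteq> pverts \<Lambda>r \<union> pverts \<Lambda>b \<longleftrightarrow>
   pverts \<Gamma> = pverts \<Lambda>r \<union> pverts \<Lambda>b \<and>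
     parcs \<Gamma> \<subseteq> pverts \<Lambda>r \<times> pverts \<Lambda>b \<union> pverts \<Lambda>b \<times> pverts \<Lambda>r" (is "?l \<longleftrightarrow> ?r")
proof
  have r: "parcs \<Lambda>r \<subseteq> pverts \<Lambda>r \<times> pverts \<Lambda>r" "\<And>u. (u, u) \<notin> parcs \<Lambda>r"
    and b: "parcs \<Lambda>b \<subseteq> pverts \<Lambda>b \<times> pverts \<Lambda>b" "\<And>u. (u, u) \<notin> parcs \<Lambda>b"
    and G: "parcs \<Gamma> \<subseteq> pverts \<Gamma> \<times> pverts \<Gamma>"
    using assms(1-3) unfolding is_tree_iff pair_graph_iff by auto
  {
    assume l: ?l
    then have sub: "parcs \<Lambda>r \<inter> parcs \<Gamma> = {}" "parcs \<Lambda>b \<inter> parcs \<Gamma> = {}"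
      "pverts \<Lambda>r \<subseteq> pverts \<Gamma>" "pverts \<Lambda>b \<subseteq> pverts \<Gamma>"
      and ind: "parcs \<Lambda>r = {e \<in> parcs \<Gamma> \<union> (parcs \<Lambda>r \<union> parcs \<Lambda>b). fst e \<in> pverts \<Lambda>r \<and> snd e \<in> pverts \<Lambda>r}"
        "parcs \<Lambda>b = {e \<in> parcs \<Gamma> \<union> (parcs \<Lambda>r \<union> parcs \<Lambda>b). fst e \<in> pverts \<Lambda>b \<and> snd e \<in> pverts \<Lambda>b}"
      and cover: "pverts \<Gamma> \<subseteq> pverts \<Lambda>r \<union> pverts \<Lambda>b"
      unfolding subgraph_def induced_subgraph_def graph_complement_def theta_graph_def by auto
    have "parcs \<Gamma> \<subseteq> pverts \<Lambda>r \<times> pverts \<Lambda>b \<union> pverts \<Lambda>b \<times> pverts \<Lambda>r"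
    proof
      fix e assume e: "e \<in> parcs \<Gamma>"
      have "\<not> (fst e \<in> pverts \<Lambda>r \<and> snd e \<in> pverts \<Lambda>r)" using e ind(1) sub(1) by blast
      moreover have "\<not> (fst e \<in> pverts \<Lambda>b \<and> snd e \<in> pverts \<Lambda>b)" using e ind(2) sub(2) by blast
      ultimately show "e \<in> pverts \<Lambda>r \<times> pverts \<Lambda>b \<union> pverts \<Lambda>b \<times> pverts \<Lambda>r"
        using e G cover by (cases e) auto
    qed
    then show ?r using cover sub by auto
  }
  {
    assume R: ?r
    have wf: "wf_digraph (with_proj \<Lambda>r)" "wf_digraph (with_proj \<Lambda>b)"
      "wf_digraph (with_proj (graph_complement \<Gamma>))" "wf_digraph (with_proj (theta_graph \<Gamma> \<Lambda>r \<Lambda>b))"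
      using r b G R unfolding wf_digraph_wp_iff pair_wf_digraph_def graph_complement_def theta_graph_def
      by auto
    have "\<And>u v. (u, v) \<in> parcs \<Lambda>r \<Longrightarrow> (u, v) \<notin> parcs \<Gamma>" "\<And>u v. (u, v) \<in> parcs \<Lambda>b \<Longrightarrow> (u, v) \<notin> parcs \<Gamma>"
      using r b R assms(4) by blast+
    then have "subgraph (with_proj \<Lambda>r) (with_proj (graph_complement \<Gamma>))"
      "subgraph (with_proj \<Lambda>b) (with_proj (graph_complement \<Gamma>))"
      "subgraph (with_proj \<Lambda>r) (with_proj (theta_graph \<Gamma> \<Lambda>r \<Lambda>b))"
      "subgraph (with_proj \<Lambda>b) (with_proj (theta_graph \<Gamma> \<Lambda>r \<Lambda>b))"
      using wf r b R assms(4) unfolding subgraph_def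
      by (auto simp: compatible_def graph_complement_def theta_graph_def)
    moreover have "parcs \<Lambda>r = {e \<in> parcs \<Gamma> \<union> (parcs \<Lambda>r \<union> parcs \<Lambda>b). fst e \<in> pverts \<Lambda>r \<and> snd e \<in> pverts \<Lambda>r}"
      by (rule induced_part[OF r(1) b(1) _ assms(4)]) (use R in simp)
    moreover have "parcs \<Lambda>b = {e \<in> parcs \<Gamma> \<union> (parcs \<Lambda>r \<union> parcs \<Lambda>b). fst e \<in> pverts \<Lambda>b \<and> snd e \<in> pverts \<Lambda>b}"
      unfolding Un_commute[of "parcs \<Lambda>r"]
      by (rule induced_part[OF b(1) r(1)]) (use R assms(4) in auto)
    ultimately show ?l using R unfolding induced_subgraph_def by (auto simp: theta_graph_def)
  }
qed

lemma FIDL_iff_relational: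
  assumes "pair_graph \<Gamma>"
  shows "FIDL \<Gamma> \<Lambda>r \<Lambda>b \<longleftrightarrow>
    is_tree \<Lambda>r \<and> is_tree \<Lambda>b \<and> pverts \<Lambda>r \<inter> pverts \<Lambda>b = {} \<and> pverts \<Gamma> = pverts \<Lambda>r \<union> pverts \<Lambda>b \<and>
    parcs \<Gamma> \<subseteq> pverts \<Lambda>r \<times> pverts \<Lambda>b \<union> pverts \<Lambda>b \<times> pverts \<Lambda>r \<and>
    relational_FIDL (pverts \<Gamma>) (parcs \<Gamma>) (parcs \<Lambda>r \<union> parcs \<Lambda>b)" (is "_ \<longleftrightarrow> ?S \<and> _")
proof (cases "is_tree \<Lambda>r \<and> is_tree \<Lambda>b \<and> pverts \<Lambda>r \<inter> pverts \<Lambda>b = {} \<and> pverts \<Gamma> = pverts \<Lambda>r \<union> pverts \<Lambda>b \<and>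
    parcs \<Gamma> \<subseteq> pverts \<Lambda>r \<times> pverts \<Lambda>b \<union> pverts \<Lambda>b \<times> pverts \<Lambda>r")
  case False
  then show ?thesis unfolding FIDL_def using FIDL_structure_iff[OF assms, of \<Lambda>r \<Lambda>b] by blast
next
  case S: True
  then interpret tree_pair \<Lambda>r \<Lambda>b by unfold_locales auto
  have G: "sym (parcs \<Gamma>)" "\<And>u. (u, u) \<notin> parcs \<Gamma>" "parcs \<Gamma> \<subseteq> pverts \<Gamma> \<times> pverts \<Gamma>"
    using assms unfolding pair_graph_iff by auto
  let ?V = "pverts \<Gamma>" and ?E = "parcs \<Gamma>"
  have V: "pverts \<Lambda>r \<union> pverts \<Lambda>b = ?V" using S by simp
  have tcf: "two_coloured_forest ?V ?E L" using two_coloured_forest[of ?E] S G by auto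
  have hull: "forest_hull \<Lambda>r \<Lambda>b T = hull_in ?V L T" if "T \<subseteq> ?V" for T
    using forest_hull_eq[of T] that V by simp
  interpret two_coloured_forest ?V ?E L by (rule tcf)
  have hull_sub: "hull_in ?V L T \<subseteq> ?V" if "T \<subseteq> ?V" for T
    using that convex_V unfolding hull_in_def by auto
  have R3: "(\<forall>a b c d. square_in \<Gamma> a b c d \<longrightarrow>
        subgraph (with_proj (join (forest_hull \<Lambda>r \<Lambda>b {a, b}) (forest_hull \<Lambda>r \<Lambda>b {c, d}))) (with_proj \<Gamma>)) \<longleftrightarrow>
      (\<forall>a b c d e f. a \<noteq> b \<longrightarrow> c \<noteq> d \<longrightarrow> (a, c) \<in> ?E \<longrightarrow> (a, d) \<in> ?E \<longrightarrow> (b, c) \<in> ?E \<longrightarrow> (b, d) \<in> ?E \<longrightarrow>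
         e \<in> hull_in ?V L {a, b} \<longrightarrow> f \<in> hull_in ?V L {c, d} \<longrightarrow> (e, f) \<in> ?E)"
  proof -
    have "subgraph (with_proj (join (forest_hull \<Lambda>r \<Lambda>b {a, b}) (forest_hull \<Lambda>r \<Lambda>b {c, d}))) (with_proj \<Gamma>) \<longleftrightarrow>
      (\<forall>e\<in>hull_in ?V L {a, b}. \<forall>f\<in>hull_in ?V L {c, d}. (e, f) \<in> ?E)" if "(a, c) \<in> ?E" "(b, d) \<in> ?E" for a b c d
    proof -
      have sub: "{a, b} \<subseteq> ?V" "{c, d} \<subseteq> ?V" using that G by auto
      show ?thesis
        unfolding join_subgraph_iff[OF assms] hull[OF sub(1)] hull[OF sub(2)]
        using hull_sub[OF sub(1)] hull_sub[OF sub(2)] by auto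
    qed
    then show ?thesis unfolding square_in_iff[OF assms] by blast
  qed
  have R4: "(\<forall>\<gamma> a b. graph_cycle \<Gamma> \<gamma> \<and> (a, b) \<in> set \<gamma> \<longrightarrow>
        (\<exists>a'\<in>forest_hull \<Lambda>r \<Lambda>b (fst ` set \<gamma>). \<exists>b'\<in>forest_hull \<Lambda>r \<Lambda>b (fst ` set \<gamma>). square_in \<Gamma> a a' b b')) \<longleftrightarrow>
      (\<forall>H a b. H \<subseteq> ?V \<longrightarrow> convex_in L H \<longrightarrow> on_cycle ?E H a b \<longrightarrow>
        (\<exists>a'\<in>H. \<exists>b'\<in>H. a' \<noteq> a \<and> b' \<noteq> b \<and> (a, b') \<in> ?E \<and> (a', b) \<in> ?E \<and> (a', b') \<in> ?E))" (is "?A \<longleftrightarrow> ?B")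
  proof
    assume A: ?A
    show ?B
    proof (intro allI impI)
      fix H a b assume H: "H \<subseteq> ?V" "convex_in L H" "on_cycle ?E H a b"
      obtain \<gamma> where \<gamma>: "graph_cycle \<Gamma> \<gamma>" "(a, b) \<in> set \<gamma>" "fst ` set \<gamma> \<subseteq> H"
        using on_cycle_graph_cycle[OF H(3,1) G(1,2)] by auto
      have hull_H: "forest_hull \<Lambda>r \<Lambda>b (fst ` set \<gamma>) \<subseteq> H"
        using hull[of "fst ` set \<gamma>"] \<gamma>(3) H unfolding hull_in_def by auto
      obtain a' b' where sq: "a' \<in> forest_hull \<Lambda>r \<Lambda>b (fst ` set \<gamma>)" "b' \<in> forest_hull \<Lambda>r \<Lambda>b (fst ` set \<gamma>)"
        "square_in \<Gamma> a a' b b'" using A \<gamma>(1,2) by metis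
      show "\<exists>a'\<in>H. \<exists>b'\<in>H. a' \<noteq> a \<and> b' \<noteq> b \<and> (a, b') \<in> ?E \<and> (a', b) \<in> ?E \<and> (a', b') \<in> ?E"
        using sq hull_H unfolding square_in_iff[OF assms] by (intro bexI[of _ a'] bexI[of _ b']) auto
    qed
  next
    assume B: ?B
    show ?A
    proof (intro allI impI)
      fix \<gamma> a b assume c: "graph_cycle \<Gamma> \<gamma> \<and> (a, b) \<in> set \<gamma>"
      let ?T = "fst ` set \<gamma>"
      have TV: "?T \<subseteq> ?V" using c G(3) unfolding graph_cycle_iff by auto
      let ?H = "forest_hull \<Lambda>r \<Lambda>b ?T"
      have H: "convex_in L ?H" "?T \<subseteq> ?H" "?H \<subseteq> ?V"
        using forest_hull_convex[of ?T] TV V by auto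
      then have cyc: "on_cycle ?E ?H a b" using c G(1,2) by (intro cycle_edge_on_cycle) auto
      obtain a' b' where sq: "a' \<in> ?H" "b' \<in> ?H" "a' \<noteq> a" "b' \<noteq> b"
        "(a, b') \<in> ?E" "(a', b) \<in> ?E" "(a', b') \<in> ?E"
        using B[rule_format, OF H(3,1) cyc] by auto
      have "(a, b) \<in> ?E" using c unfolding graph_cycle_iff by auto
      then have "square_in \<Gamma> a a' b b'" unfolding square_in_iff[OF assms] using sq by auto
      then show "\<exists>a'\<in>?H. \<exists>b'\<in>?H. square_in \<Gamma> a a' b b'" using sq(1,2) by auto
    qed
  qed
  have rel: "relational_FIDL ?V ?E L \<longleftrightarrow>
      (\<forall>a b c d e f. a \<noteq> b \<longrightarrow> c \<noteq> d \<longrightarrow> (a, c) \<in> ?E \<longrightarrow> (a, d) \<in> ?E \<longrightarrow> (b, c) \<in> ?E \<longrightarrow> (b, d) \<in> ?E \<longrightarrow>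
         e \<in> hull_in ?V L {a, b} \<longrightarrow> f \<in> hull_in ?V L {c, d} \<longrightarrow> (e, f) \<in> ?E) \<and>
      (\<forall>H a b. H \<subseteq> ?V \<longrightarrow> convex_in L H \<longrightarrow> on_cycle ?E H a b \<longrightarrow>
        (\<exists>a'\<in>H. \<exists>b'\<in>H. a' \<noteq> a \<and> b' \<noteq> b \<and> (a, b') \<in> ?E \<and> (a', b) \<in> ?E \<and> (a', b') \<in> ?E))"
    unfolding relational_FIDL_def relational_FIDL_axioms_def using tcf by blast
  have pg: "pair_graph \<Lambda>r" "pair_graph \<Lambda>b" "connected (with_proj \<Lambda>r)" "connected (with_proj \<Lambda>b)"
    using trees unfolding is_tree_def by auto
  show ?thesis
    unfolding FIDL_def R3 R4 L_def[symmetric] rel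
    using FIDL_structure_iff[OF assms trees disjoint] S pg by blast
qed

text \<open>
  The trees \<open>\<Lambda>r\<close> and \<open>\<Lambda>b\<close> are recovered from \<open>L\<close> as the components of the two ends of an edge
  of \<open>\<Gamma>\<close>.
\<close>

lemma (in two_coloured_forest) component_is_tree:
  assumes "r \<in> V"
  defines "R \<equiv> {u \<in> V. (r, u) \<in> L\<^sup>*}"
  shows "is_tree \<lparr>pverts = R, parcs = L \<inter> R \<times> R\<rparr>"
proof -
  have "(u, w) \<in> (L \<inter> R \<times> R)\<^sup>*" if uw: "u \<in> R" "w \<in> R" for u w
  proof -
    have "(u, w) \<in> L\<^sup>*" using uw Lstar_commute unfolding R_def by (auto intro: rtrancl_trans)
    then have "(u, w) \<in> (L \<inter> R \<times> R)\<^sup>* \<and> w \<in> R"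
    proof induction
      case (step s t)
      then have "(s, t) \<in> L \<inter> R \<times> R"
        using L_V unfolding R_def by (auto intro: rtrancl_into_rtrancl)
      then show ?case using step by (auto intro: rtrancl_into_rtrancl)
    qed (use uw in auto)
    then show ?thesis by simp
  qed
  then have "conn_on (L \<inter> R \<times> R) R" unfolding conn_on_def by (simp add: Int_assoc)
  moreover have "(u, v) \<notin> (L \<inter> R \<times> R - {(u, v), (v, u)})\<^sup>*" if "(u, v) \<in> L" for u v
    using L_bridge[OF that] rtrancl_mono[of "L \<inter> R \<times> R - {(u, v), (v, u)}" "L - {(u, v), (v, u)}"] by blast
  moreover have "pair_graph \<lparr>pverts = R, parcs = L \<inter> R \<times> R\<rparr>"
    unfolding pair_graph_iff using finite_V sym_restrict[OF L_sym] L_irrefl unfolding R_def by auto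
  moreover have "R \<noteq> {}" using assms(1) unfolding R_def by auto
  ultimately show ?thesis unfolding is_tree_iff by auto
qed

lemma FIDL_exists_iff_relational:
  assumes "pair_graph \<Gamma>" "(r, b) \<in> parcs \<Gamma>"
  shows "(\<exists>\<Lambda>r \<Lambda>b. FIDL \<Gamma> \<Lambda>r \<Lambda>b) \<longleftrightarrow> (\<exists>L. relational_FIDL (pverts \<Gamma>) (parcs \<Gamma>) L)"
proof
  assume "\<exists>L. relational_FIDL (pverts \<Gamma>) (parcs \<Gamma>) L"
  then obtain L where rel: "relational_FIDL (pverts \<Gamma>) (parcs \<Gamma>) L" by auto
  then interpret relational_FIDL "pverts \<Gamma>" "parcs \<Gamma>" L .
  define R where "R = {u \<in> pverts \<Gamma>. (r, u) \<in> L\<^sup>*}"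
  define B where "B = {u \<in> pverts \<Gamma>. (b, u) \<in> L\<^sup>*}"
  have rb: "r \<in> pverts \<Gamma>" "b \<in> pverts \<Gamma>" using E_V assms(2) by auto
  have disj: "R \<inter> B = {}"
  proof -
    have "(r, b) \<in> L\<^sup>*" if "u \<in> R" "u \<in> B" for u
      using that Lstar_commute unfolding R_def B_def by (auto intro: rtrancl_trans)
    then show ?thesis using E_colour[OF assms(2)] by auto
  qed
  have cover: "pverts \<Gamma> = R \<union> B" using two_colours[OF assms(2)] unfolding R_def B_def by auto
  have same: "(u, w) \<in> L\<^sup>*" if "u \<in> R \<and> w \<in> R \<or> u \<in> B \<and> w \<in> B" for u w
    using that Lstar_commute unfolding R_def B_def by (auto intro: rtrancl_trans)
  have arcs: "parcs \<Gamma> \<subseteq> R \<times> B \<union> B \<times> R"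
  proof
    fix e assume e: "e \<in> parcs \<Gamma>"
    then show "e \<in> R \<times> B \<union> B \<times> R"
      using E_V[of "fst e" "snd e"] E_colour[of "fst e" "snd e"] same[of "fst e" "snd e"] cover by (cases e) auto
  qed
  have "L \<subseteq> R \<times> R \<union> B \<times> B"
  proof
    fix e assume e: "e \<in> L"
    then have "fst e \<in> R \<and> snd e \<in> R \<or> fst e \<in> B \<and> snd e \<in> B"
      using L_V[of "fst e" "snd e"] cover unfolding R_def B_def
      by (cases e) (auto intro: rtrancl_into_rtrancl)
    then show "e \<in> R \<times> R \<union> B \<times> B" by (cases e) auto
  qed
  then have L: "L \<inter> R \<times> R \<union> L \<inter> B \<times> B = L" by auto
  have "FIDL \<Gamma> \<lparr>pverts = R, parcs = L \<inter> R \<times> R\<rparr> \<lparr>pverts = B, parcs = L \<inter> B \<times> B\<rparr>"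
    unfolding FIDL_iff_relational[OF assms(1)]
    using component_is_tree[OF rb(1)] component_is_tree[OF rb(2)] disj cover arcs rel L
    unfolding R_def[symmetric] B_def[symmetric] by simp
  then show "\<exists>\<Lambda>r \<Lambda>b. FIDL \<Gamma> \<Lambda>r \<Lambda>b" by blast
qed (use FIDL_iff_relational[OF assms(1)] in blast)

section \<open>Dismantling sequences\<close>

lemma no_separating_clique_restrict:
  assumes "no_separating_clique E H" shows "no_separating_clique (E \<inter> H \<times> H) H"
  unfolding no_separating_clique_def
proof (intro allI impI)
  fix C assume C: "C \<subseteq> H" "\<forall>u\<in>C. \<forall>v\<in>C. u \<noteq> v \<longrightarrow> (u, v) \<in> E \<inter> H \<times> H"
  then have "conn_on E (H - C)" by (intro no_separating_cliqueD[OF assms]) auto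
  moreover have "E \<inter> H \<times> H \<inter> (H - C) \<times> (H - C) = E \<inter> (H - C) \<times> (H - C)" by auto
  ultimately show "conn_on (E \<inter> H \<times> H) (H - C)" unfolding conn_on_def by simp
qed

lemma complete_graph_iff:
  "complete_graph G \<longleftrightarrow> (\<forall>u\<in>pverts G. \<forall>v\<in>pverts G. u \<noteq> v \<longrightarrow> (u, v) \<in> parcs G)"
  by (simp add: complete_graph_def clique_def)

lemma triangle_free_subset: "triangle_free G \<Longrightarrow> parcs H \<subseteq> parcs G \<Longrightarrow> triangle_free H"
  unfolding triangle_free_def by blast

lemma induced_subgraph_iff:
  assumes "pair_graph G"
  shows "induced_subgraph (with_proj H) (with_proj G) \<longleftrightarrow>
    pverts H \<subseteq> pverts G \<and> parcs H = parcs G \<inter> pverts H \<times> pverts H"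
proof
  assume "induced_subgraph (with_proj H) (with_proj G)"
  then show "pverts H \<subseteq> pverts G \<and> parcs H = parcs G \<inter> pverts H \<times> pverts H"
    unfolding induced_subgraph_def subgraph_def by auto
next
  assume H: "pverts H \<subseteq> pverts G \<and> parcs H = parcs G \<inter> pverts H \<times> pverts H"
  then have "wf_digraph (with_proj H)" "wf_digraph (with_proj G)"
    using assms unfolding wf_digraph_wp_iff pair_wf_digraph_def pair_graph_iff by auto
  then show "induced_subgraph (with_proj H) (with_proj G)"
    using H unfolding induced_subgraph_def subgraph_def by (auto simp: compatible_def)
qed

lemma pair_graph_induced:
  assumes "pair_graph G" "pverts H \<subseteq> pverts G" "parcs H = parcs G \<inter> pverts H \<times> pverts H"
  shows "pair_graph H"
  using assms unfolding pair_graph_iff by (auto intro: finite_subset sym_restrict)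

text \<open>
  The vertex sets from \<open>dismantling_exists\<close> induce a dismantling sequence of graphs; \<open>x (Suc i)\<close> is a
  satellite of its tree parent \<open>v i\<close>, which also is the required dominator.
\<close>

lemma dismantling_from_FIDL:
  assumes "pair_graph \<Gamma>" "\<not> complete_graph \<Gamma>" "triangle_free \<Gamma>" "\<not> has_separating_clique \<Gamma>"
    and "relational_FIDL (pverts \<Gamma>) (parcs \<Gamma>) L"
  shows "\<exists>n G x. G n = \<Gamma> \<and> satellite_dismantling G x n \<and> is_square (G 0) \<and>
       (\<forall>i\<le>n. \<not> complete_graph (G i) \<and> triangle_free (G i) \<and> \<not> has_separating_clique (G i)) \<and>
       (\<forall>i<n. \<exists>v\<in>dominators G x i. \<forall>j. i < j \<and> j < n \<and>
          x (Suc i) \<in> deleted_link G x j \<and> deleted_link G x j \<inter> pverts (G i) \<noteq> {} \<longrightarrow>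
          v \<in> deleted_link G x j)"
proof -
  define V where "V = pverts \<Gamma>"
  define E where "E = parcs \<Gamma>"
  interpret relational_FIDL V E L using assms(5) unfolding V_def E_def .
  have no_separating_clique_V: "no_separating_clique E V"
    using assms(1,4) has_separating_clique_iff[of \<Gamma>] unfolding V_def E_def pair_graph_iff by auto
  obtain p q where pq: "p \<in> V" "q \<in> V" "p \<noteq> q" "(p, q) \<notin> E"
    using assms(2) unfolding complete_graph_iff V_def E_def by auto
  obtain n h x v a b c d where
    hn: "h n = V" and h0: "h 0 = {a, b, c, d}" and ab: "(a, b) \<in> L" "(c, d) \<in> L"
    and sq: "(a, c) \<in> E" "(a, d) \<in> E" "(b, c) \<in> E" "(b, d) \<in> E"
    and ok: "\<And>i. i \<le> n \<Longrightarrow> h i \<subseteq> V \<and> no_separating_clique E (h i) \<and> \<not> (\<forall>u\<in>h i. \<forall>v\<in>h i. u \<noteq> v \<longrightarrow> (u, v) \<in> E)"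
    and step: "\<And>i. i < n \<Longrightarrow> x (Suc i) \<notin> h i \<and> h (Suc i) = insert (x (Suc i)) (h i) \<and> v i \<in> h i \<and>
        (\<forall>y\<in>h i. (x (Suc i), y) \<in> E \<longrightarrow> (v i, y) \<in> E)"
    and cond: "\<And>i j z. i < j \<Longrightarrow> j < n \<Longrightarrow> z \<in> h i \<Longrightarrow> (x (Suc j), x (Suc i)) \<in> E \<Longrightarrow> (x (Suc j), z) \<in> E \<Longrightarrow>
        (x (Suc j), v i) \<in> E"
    by (rule dismantling_exists[OF no_separating_clique_V pq]) (rule that)
  define G where "G i = \<lparr>pverts = h i, parcs = E \<inter> h i \<times> h i\<rparr>" for i
  have G_simps [simp]: "pverts (G i) = h i" "parcs (G i) = E \<inter> h i \<times> h i" for i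
    unfolding G_def by simp_all
  have Gn: "G n = \<Gamma>"
    unfolding G_def hn using E_sub by (cases \<Gamma>) (auto simp: V_def E_def)
  have G_graph: "pair_graph (G i)" if "i \<le> n" for i
    using pair_graph_induced[OF assms(1), of "G i"] ok[OF that] by (simp add: V_def E_def)
  have link: "link (G i) u = {w \<in> h i. (u, w) \<in> E}" if "u \<in> h i" for i u
    using that unfolding link_def by auto
  have link_x: "link (G (Suc i)) (x (Suc i)) = {w \<in> h i. (x (Suc i), w) \<in> E}" if "i < n" for i
    using link[of "x (Suc i)" "Suc i"] step[OF that] E_irrefl by auto
  have dom: "link (G (Suc i)) (x (Suc i)) \<subseteq> link (G i) (v i)" if "i < n" for i
    using link_x[OF that] link[of "v i" i] step[OF that] by auto
  have grow: "h (Suc i) = insert (x (Suc i)) (h i)" if "i < n" for i using step[OF that] by auto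
  have h_mono: "h i \<subseteq> h j" if "i \<le> j" "j \<le> n" for i j
    using that
  proof (induction rule: dec_induct)
    case (step k)
    moreover have "h (Suc k) = insert (x (Suc k)) (h k)" using grow step by auto
    ultimately show ?case by auto
  qed simp
  have "satellite_dismantling G x n"
    unfolding satellite_dismantling_def
  proof (intro allI impI conjI)
    fix i assume i: "i < n"
    have "link (G i) (v i) \<subseteq> link (G (Suc i)) (v i)"
      using link[of "v i" i] link[of "v i" "Suc i"] step[OF i] by auto
    then show "satellite (G (Suc i)) (x (Suc i))"
      unfolding satellite_def satellite_of_def
      using dom[OF i] step[OF i] by (intro exI[of _ "v i"]) auto
    show "induced_subgraph (with_proj (G i)) (with_proj (G (Suc i)))"
      using induced_subgraph_iff[OF G_graph[of "Suc i"], of "G i"] step[OF i] i by auto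
    show "pverts (G i) = pverts (G (Suc i)) - {x (Suc i)}" using step[OF i] by auto
  qed
  moreover have "is_square (G 0)"
  proof -
    have same: "(s, t) \<notin> E" if "s \<in> {a, b} \<and> t \<in> {a, b} \<or> s \<in> {c, d} \<and> t \<in> {c, d}" for s t
    proof -
      have "s = t \<or> (s, t) \<in> L" using that ab L_commute by auto
      then show ?thesis using E_colour by blast
    qed
    have cross: "(s, t) \<in> E" "(t, s) \<in> E" if "s \<in> {a, b}" "t \<in> {c, d}" for s t
      using that sq sq[THEN E_commute] by auto
    have arcs0: "E \<inter> h 0 \<times> h 0 = {a, b} \<times> {c, d} \<union> {c, d} \<times> {a, b}"
    proof (intro equalityI subrelI)
      fix s t assume "(s, t) \<in> E \<inter> h 0 \<times> h 0"
      then show "(s, t) \<in> {a, b} \<times> {c, d} \<union> {c, d} \<times> {a, b}" using same[of s t] unfolding h0 by auto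
    next
      fix s t assume "(s, t) \<in> {a, b} \<times> {c, d} \<union> {c, d} \<times> {a, b}"
      then show "(s, t) \<in> E \<inter> h 0 \<times> h 0" using cross[of s t] cross[of t s] unfolding h0 by auto
    qed
    moreover have "distinct [a, b, c, d]"
    proof -
      have "a \<noteq> b" "c \<noteq> d" using ab L_irrefl by auto
      moreover have "a \<noteq> c" "a \<noteq> d" "b \<noteq> c" "b \<noteq> d" using sq E_irrefl by auto
      ultimately show ?thesis by simp
    qed
    moreover have "G 0 = join {a, b} {c, d}" unfolding G_def join_def arcs0 using h0 by auto
    ultimately show ?thesis unfolding is_square_def by blast
  qed
  moreover have "\<not> complete_graph (G i) \<and> triangle_free (G i) \<and> \<not> has_separating_clique (G i)" if i: "i \<le> n" for i
  proof (intro conjI)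
    show "\<not> complete_graph (G i)" using ok[OF i] unfolding complete_graph_iff by auto
    show "triangle_free (G i)" by (rule triangle_free_subset[OF assms(3)]) (auto simp: E_def)
    show "\<not> has_separating_clique (G i)"
      using has_separating_clique_iff[of "G i"] G_graph[OF i] ok[OF i] no_separating_clique_restrict
      unfolding pair_graph_iff by auto
  qed
  moreover have "\<exists>v\<in>dominators G x i. \<forall>j. i < j \<and> j < n \<and>
          x (Suc i) \<in> deleted_link G x j \<and> deleted_link G x j \<inter> pverts (G i) \<noteq> {} \<longrightarrow>
          v \<in> deleted_link G x j" if i: "i < n" for i
  proof (intro bexI[of _ "v i"] allI impI)
    show "v i \<in> dominators G x i"
      unfolding dominators_def deleted_link_def using dom[OF i] step[OF i] by auto
    fix j assume j: "i < j \<and> j < n \<and> x (Suc i) \<in> deleted_link G x j \<and> deleted_link G x j \<inter> pverts (G i) \<noteq> {}"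
    then have dl: "deleted_link G x j = {w \<in> h j. (x (Suc j), w) \<in> E}"
      unfolding deleted_link_def using link_x by auto
    obtain z where "z \<in> h i" "(x (Suc j), z) \<in> E" "(x (Suc j), x (Suc i)) \<in> E"
      using j unfolding dl by auto
    then have "(x (Suc j), v i) \<in> E" using cond j by blast
    moreover have "v i \<in> h j" using h_mono[of i j] j step[OF i] by auto
    ultimately show "v i \<in> deleted_link G x j" unfolding dl by simp
  qed
  ultimately show ?thesis using Gn by blast
qed

text \<open>
  The vertex sets of the sequence, with the chosen dominators as parents, are the data from which the
  forest is built leaf by leaf.
\<close>

lemma FIDL_from_dismantling_sequence:
  fixes \<Gamma> :: "'a pair_pre_digraph"
  assumes "pair_graph \<Gamma>" "G n = \<Gamma>" "satellite_dismantling G x n" "is_square (G 0)"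
    and cond: "\<forall>i<n. \<exists>v\<in>dominators G x i. \<forall>j. i < j \<and> j < n \<and>
          x (Suc i) \<in> deleted_link G x j \<and> deleted_link G x j \<inter> pverts (G i) \<noteq> {} \<longrightarrow>
          v \<in> deleted_link G x j"
  shows "\<exists>L. relational_FIDL (pverts \<Gamma>) (parcs \<Gamma>) L" and "\<exists>r b. (r, b) \<in> parcs \<Gamma>"
proof -
  define E where "E = parcs \<Gamma>"
  define h where "h i = pverts (G i)" for i
  have \<Gamma>: "finite (h n)" "E \<subseteq> h n \<times> h n" "sym E" "\<And>u. (u, u) \<notin> E"
    using assms(1,2) unfolding pair_graph_iff h_def E_def by auto
  have sat: "satellite (G (Suc i)) (x (Suc i))"
    and ind: "parcs (G i) = {e \<in> parcs (G (Suc i)). fst e \<in> h i \<and> snd e \<in> h i}"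
    and del: "h i = h (Suc i) - {x (Suc i)}" if "i < n" for i
    using assms(3) that unfolding satellite_dismantling_def induced_subgraph_def h_def by auto
  have hS: "x (Suc i) \<notin> h i" "h (Suc i) = insert (x (Suc i)) (h i)" if "i < n" for i
    using del[OF that] sat[OF that] unfolding satellite_def satellite_of_def h_def by auto
  have arcs: "parcs (G i) = E \<inter> h i \<times> h i" if "i \<le> n" for i
    using that
  proof (induction rule: inc_induct)
    case base
    then show ?case using assms(2) \<Gamma>(2) unfolding E_def by auto
  next
    case (step i)
    then show ?case using ind[of i] hS(2)[of i] by auto
  qed
  obtain a b c d where base: "distinct [a, b, c, d]" "G 0 = join {a, b} {c, d}"
    using assms(4) unfolding is_square_def by auto
  have base': "h 0 = {a, b, c, d}" "E \<inter> h 0 \<times> h 0 = {a, b} \<times> {c, d} \<union> {c, d} \<times> {a, b}"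
    using base arcs[of 0] unfolding h_def join_def by auto
  then have "(a, c) \<in> E" by auto
  then show "\<exists>r b. (r, b) \<in> parcs \<Gamma>" unfolding E_def by auto
  have dl: "deleted_link G x i = {u \<in> h i. (x (Suc i), u) \<in> E}" if "i < n" for i
    using arcs[of "Suc i"] hS[OF that] that \<Gamma>(4) unfolding deleted_link_def link_def h_def[symmetric] by auto
  obtain v where v: "\<And>i. i < n \<Longrightarrow> v i \<in> dominators G x i"
    and v_cond: "\<And>i j. i < n \<Longrightarrow> i < j \<and> j < n \<and>
          x (Suc i) \<in> deleted_link G x j \<and> deleted_link G x j \<inter> pverts (G i) \<noteq> {} \<Longrightarrow>
          v i \<in> deleted_link G x j"
    using cond by metis
  have h_mono: "h i \<subseteq> h j" if "i \<le> j" "j \<le> n" for i j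
    using that
  proof (induction rule: dec_induct)
    case (step k)
    then show ?case using hS(2)[of k] by auto
  qed simp
  show "\<exists>L. relational_FIDL (pverts \<Gamma>) (parcs \<Gamma>) L"
  proof (rule FIDL_from_dismantling[of E h n a b c d x v])
    show "x (Suc i) \<notin> h i \<and> h (Suc i) = insert (x (Suc i)) (h i) \<and> v i \<in> h i \<and>
        (\<forall>y\<in>h i. (x (Suc i), y) \<in> E \<longrightarrow> (v i, y) \<in> E)" if "i < n" for i
      using hS[OF that] v[OF that] dl[OF that] arcs[of i] that
      unfolding dominators_def link_def h_def[symmetric] by auto
    show "(x (Suc j), v i) \<in> E" if "i < j" "j < n" "z \<in> h i" "(x (Suc j), x (Suc i)) \<in> E" "(x (Suc j), z) \<in> E" for i j z
    proof -
      have "h i \<subseteq> h j" "h (Suc i) \<subseteq> h j" using h_mono that by auto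
      then have "x (Suc i) \<in> deleted_link G x j" "z \<in> deleted_link G x j"
        using dl[OF that(2)] that hS(2)[of i] by auto
      then have "v i \<in> deleted_link G x j" using v_cond[of i j] that unfolding h_def by auto
      then show ?thesis using dl[OF that(2)] by simp
    qed
    show "\<exists>L. relational_FIDL (pverts \<Gamma>) (parcs \<Gamma>) L" if "relational_FIDL (h n) E L" for L
      using that assms(2) unfolding h_def E_def by auto
  qed (use \<Gamma> base base' in auto)
qed

theorem theorem4p7:
  fixes \<Gamma> :: "'a pair_pre_digraph"
  assumes "pair_graph \<Gamma>"
    and "\<not> complete_graph \<Gamma>"
    and "triangle_free \<Gamma>"
    and "\<not> has_separating_clique \<Gamma>"
  shows "(\<exists>\<Lambda>r \<Lambda>b. FIDL \<Gamma> \<Lambda>r \<Lambda>b) \<longleftrightarrow>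
    (\<exists>n G x. G n = \<Gamma> \<and> satellite_dismantling G x n \<and> is_square (G 0) \<and>
       (\<forall>i\<le>n. \<not> complete_graph (G i) \<and> triangle_free (G i) \<and> \<not> has_separating_clique (G i)) \<and>
       (\<forall>i<n. \<exists>v\<in>dominators G x i. \<forall>j. i < j \<and> j < n \<and>
          x (Suc i) \<in> deleted_link G x j \<and> deleted_link G x j \<inter> pverts (G i) \<noteq> {} \<longrightarrow>
          v \<in> deleted_link G x j))"
proof
  assume "\<exists>\<Lambda>r \<Lambda>b. FIDL \<Gamma> \<Lambda>r \<Lambda>b"
  then obtain L where "relational_FIDL (pverts \<Gamma>) (parcs \<Gamma>) L"
    using FIDL_iff_relational[OF assms(1)] by blast
  then show "\<exists>n G x. G n = \<Gamma> \<and> satellite_dismantling G x n \<and> is_square (G 0) \<and>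
       (\<forall>i\<le>n. \<not> complete_graph (G i) \<and> triangle_free (G i) \<and> \<not> has_separating_clique (G i)) \<and>
       (\<forall>i<n. \<exists>v\<in>dominators G x i. \<forall>j. i < j \<and> j < n \<and>
          x (Suc i) \<in> deleted_link G x j \<and> deleted_link G x j \<inter> pverts (G i) \<noteq> {} \<longrightarrow>
          v \<in> deleted_link G x j)"
    by (rule dismantling_from_FIDL[OF assms])
next
  assume "\<exists>n G x. G n = \<Gamma> \<and> satellite_dismantling G x n \<and> is_square (G 0) \<and>
       (\<forall>i\<le>n. \<not> complete_graph (G i) \<and> triangle_free (G i) \<and> \<not> has_separating_clique (G i)) \<and>
       (\<forall>i<n. \<exists>v\<in>dominators G x i. \<forall>j. i < j \<and> j < n \<and>
          x (Suc i) \<in> deleted_link G x j \<and> deleted_link G x j \<inter> pverts (G i) \<noteq> {} \<longrightarrow>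
          v \<in> deleted_link G x j)"
  then obtain n G x where "G n = \<Gamma>" "satellite_dismantling G x n" "is_square (G 0)"
    "\<forall>i<n. \<exists>v\<in>dominators G x i. \<forall>j. i < j \<and> j < n \<and>
          x (Suc i) \<in> deleted_link G x j \<and> deleted_link G x j \<inter> pverts (G i) \<noteq> {} \<longrightarrow>
          v \<in> deleted_link G x j" by metis
  from FIDL_from_dismantling_sequence[OF assms(1) this]
  show "\<exists>\<Lambda>r \<Lambda>b. FIDL \<Gamma> \<Lambda>r \<Lambda>b" using FIDL_exists_iff_relational[OF assms(1)] by blast
qed

end
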